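(* The triplet $(H_{\mathbb{T}},C_{\mathbb{T}},\mu_{\mathbb{T}})$ is an abstract Wiener space.
   Context: $\mathbb{T}$ is a closed subset of $\mathbb{R}$ with $\{0,1\}\subset\mathbb{T}\subset[0,1]$; $[0,t)_{\mathbb{T}}:=[0,t)\cap\mathbb{T}$. Let $\bar\rho:[0,1]\to\mathbb{T}$ be $\bar\rho(t):=\sup\{u\in\mathbb{T}:u<t\}$ for $t\in(0,1]$ and $\bar\rho(0):=0$; $\lambda_\Delta:=\bar\rho_\star\lambda$ is the pushforward to $(\mathbb{T},\mathcal{B}(\mathbb{T}))$ of Lebesgue measure $\lambda$ on $[0,1]$. $C_{\mathbb{T}}$ is the separable Banach space of continuous $\omega:\mathbb{T}\to\mathbb{R}$ with $\omega(0)=0$, with the sup norm. The sampled Wiener measure $\mu_{\mathbb{T}}$ is the law on $C_{\mathbb{T}}$ of $(B_t)_{t\in\mathbb{T}}$, where $(B_t)_{t\in[0,1]}$ is a standard Brownian motion started at $0$. $H_{\mathbb{T}}$ is the separable Hilbert space of $h\in C_{\mathbb{T}}$ of the form $h(t)=\int_{[0,t)_{\mathbb{T}}}h^\Delta(s)\lambda_\Delta(ds)$, $t\in\mathbb{T}$, with $h^\Delta\in L^2(\lambda_\Delta)$, with scalar product $\langle h,k\rangle_{H_{\mathbb{T}}}=\int_{\mathbb{T}}h^\Delta k^\Delta\,d\lambda_\Delta$. A triplet $(H,E,\mu)$ is an abstract Wiener space if $H$ is a separable Hilbert space continuously and densely injected in a separable Banach space $E$, and $\mu$ is a Borel probability measure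 on $E$ such that $\int_E\exp(i\langle l,\omega\rangle_{E^\star,E})\mu(d\omega)=\exp(-\|j(l)\|_H^2/2)$ for all $l\in E^\star$, where $j(l)\in H$ is the unique element with $\langle j(l),h\rangle_H=\langle l,h\rangle_{E^\star,E}$ for all $h\in H$. *)

theory Defs
  imports "HOL-Probability.Probability" "HOL-Library.Function_Algebras"
begin

instantiation "fun" :: (type, real_vector) real_vector
begin

definition scaleR_fun :: "real \<Rightarrow> ('a \<Rightarrow> 'b) \<Rightarrow> 'a \<Rightarrow> 'b"
  where "scaleR_fun c f = (\<lambda>x. c *\<^sub>R f x)"

instance
  by standard (simp_all add: scaleR_fun_def fun_eq_iff scaleR_add_right scaleR_add_left)

end


section \<open>Banach and Hilbert spaces carried by a linear subspace\<close>

text \<open>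
  The spaces below depend on a set, not on a type. A normed space is therefore given by a linear
  subspace \<open>V\<close> of an ambient real vector space together with a norm \<open>N\<close> of which only the values
  on \<open>V\<close> matter.
\<close>

text \<open>The value \<open>0\<close> off \<open>V\<close> is there because the locale \<open>Metric_space\<close> demands nonnegativity
  and symmetry on the whole type.\<close>

definition norm_dist :: "'a::real_vector set \<Rightarrow> ('a \<Rightarrow> real) \<Rightarrow> 'a \<Rightarrow> 'a \<Rightarrow> real"
  where "norm_dist V N x y = (if x \<in> V \<and> y \<in> V then N (x - y) else 0)"

definition norm_topology :: "'a::real_vector set \<Rightarrow> ('a \<Rightarrow> real) \<Rightarrow> 'a topology"
  where "norm_topology V N = Metric_space.mtopology V (norm_dist V N)"

definition norm_borel :: "'a::real_vector set \<Rightarrow> ('a \<Rightarrow> real) \<Rightarrow> 'a measure"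
  where "norm_borel V N = sigma V {U. openin (norm_topology V N) U}"

definition linear_between ::
    "'a::real_vector set \<Rightarrow> 'b::real_vector set \<Rightarrow> ('a \<Rightarrow> 'b) \<Rightarrow> bool"
  where "linear_between V W f \<longleftrightarrow>
    f ` V \<subseteq> W \<and>
    (\<forall>x\<in>V. \<forall>y\<in>V. f (x + y) = f x + f y) \<and>
    (\<forall>c. \<forall>x\<in>V. f (c *\<^sub>R x) = c *\<^sub>R f x)"

locale separable_banach_on =
  fixes V :: "'a::real_vector set" and N :: "'a \<Rightarrow> real"
  assumes subspace_carrier: "subspace V"
    and norm_nonneg: "x \<in> V \<Longrightarrow> 0 \<le> N x"
    and norm_eq_0_iff: "x \<in> V \<Longrightarrow> N x = 0 \<longleftrightarrow> x = 0"
    and norm_scaleR: "x \<in> V \<Longrightarrow> N (c *\<^sub>R x) = \<bar>c\<bar> * N x"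
    and norm_triangle: "x \<in> V \<Longrightarrow> y \<in> V \<Longrightarrow> N (x + y) \<le> N x + N y"
    and complete: "Metric_space.mcomplete V (norm_dist V N)"
    and separable: "separable_space (norm_topology V N)"

definition inner_norm :: "('a \<Rightarrow> 'a \<Rightarrow> real) \<Rightarrow> 'a \<Rightarrow> real"
  where "inner_norm ip x = sqrt (ip x x)"

locale separable_hilbert_on =
  fixes V :: "'a::real_vector set" and ip :: "'a \<Rightarrow> 'a \<Rightarrow> real"
  assumes subspace_carrier: "subspace V"
    and inner_commute: "x \<in> V \<Longrightarrow> y \<in> V \<Longrightarrow> ip x y = ip y x"
    and inner_add_left: "x \<in> V \<Longrightarrow> y \<in> V \<Longrightarrow> z \<in> V \<Longrightarrow> ip (x + y) z = ip x z + ip y z"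
    and inner_scaleR_left: "x \<in> V \<Longrightarrow> y \<in> V \<Longrightarrow> ip (c *\<^sub>R x) y = c * ip x y"
    and inner_nonneg: "x \<in> V \<Longrightarrow> 0 \<le> ip x x"
    and inner_eq_0_iff: "x \<in> V \<Longrightarrow> ip x x = 0 \<longleftrightarrow> x = 0"
    and complete: "Metric_space.mcomplete V (norm_dist V (inner_norm ip))"
    and separable: "separable_space (norm_topology V (inner_norm ip))"


section \<open>Abstract Wiener spaces\<close>

text \<open>Membership in the dual, and every use of its elements below, only involves values on \<open>V\<close>.\<close>

definition dual_on :: "'a::real_vector set \<Rightarrow> ('a \<Rightarrow> real) \<Rightarrow> ('a \<Rightarrow> real) set"
  where "dual_on V N =
    {l. linear_between V UNIV l \<and> continuous_map (norm_topology V N) euclideanreal l}"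

text \<open>For \<open>V\<close> a Hilbert space and \<open>\<iota>\<close> a continuous linear map into a normed space, existence and
  uniqueness of this element for each \<open>l\<close> in the dual are the Riesz representation theorem.\<close>

definition riesz_rep ::
    "'h set \<Rightarrow> ('h \<Rightarrow> 'h \<Rightarrow> real) \<Rightarrow> ('h \<Rightarrow> 'e) \<Rightarrow> ('e \<Rightarrow> real) \<Rightarrow> 'h"
  where "riesz_rep V ip \<iota> l = (THE k. k \<in> V \<and> (\<forall>h\<in>V. ip k h = l (\<iota> h)))"

locale abstract_wiener_space =
  H: separable_hilbert_on H ip + E: separable_banach_on E N
  for H :: "'h::real_vector set" and ip :: "'h \<Rightarrow> 'h \<Rightarrow> real"
    and E :: "'e::real_vector set" and N :: "'e \<Rightarrow> real" +
  fixes \<iota> :: "'h \<Rightarrow> 'e" and \<mu> :: "'e measure"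
  assumes embedding_linear: "linear_between H E \<iota>"
    and embedding_inj: "inj_on \<iota> H"
    and embedding_continuous:
      "continuous_map (norm_topology H (inner_norm ip)) (norm_topology E N) \<iota>"
    and embedding_dense: "norm_topology E N closure_of (\<iota> ` H) = E"
    and prob_space: "prob_space \<mu>"
    and sets_eq_borel: "sets \<mu> = sets (norm_borel E N)"
    and characteristic_functional:
      "l \<in> dual_on E N \<Longrightarrow>
        (LINT \<omega>|\<mu>. exp (\<i> * complex_of_real (l \<omega>))) =
        complex_of_real (exp (- (inner_norm ip (riesz_rep H ip \<iota> l))\<^sup>2 / 2))"


section \<open>Standard Brownian motion on the unit interval\<close>

text \<open>All paths are continuous and start at \<open>0\<close>, so that the process is a random element of a
  space of continuous functions. The second parameter of \<open>normal_density\<close> is the standard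
  deviation.\<close>

locale standard_brownian_motion = prob_space M
  for M :: "'w measure" +
  fixes B :: "real \<Rightarrow> 'w \<Rightarrow> real"
  assumes random_variable: "t \<in> {0..1} \<Longrightarrow> B t \<in> borel_measurable M"
    and start: "w \<in> space M \<Longrightarrow> B 0 w = 0"
    and continuous_paths: "w \<in> space M \<Longrightarrow> continuous_on {0..1} (\<lambda>t. B t w)"
    and independent_increments:
      "\<tau> ` {..n} \<subseteq> {0..1} \<Longrightarrow> (\<And>i. i < n \<Longrightarrow> \<tau> i < \<tau> (Suc i)) \<Longrightarrow>
        indep_vars (\<lambda>_. borel) (\<lambda>i w. B (\<tau> (Suc i)) w - B (\<tau> i) w) {..<n::nat}"
    and gaussian_increments:
      "0 \<le> s \<Longrightarrow> s < t \<Longrightarrow> t \<le> 1 \<Longrightarrow>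
        distributed M lborel (\<lambda>w. B t w - B s w) (normal_density 0 (sqrt (t - s)))"


section \<open>The sampled Wiener space\<close>

definition rho_bar :: "real set \<Rightarrow> real \<Rightarrow> real"
  where "rho_bar T t = (if t = 0 then 0 else Sup {u \<in> T. u < t})"

definition lambda_Delta :: "real set \<Rightarrow> real measure"
  where "lambda_Delta T =
    distr (restrict_space lborel {0..1}) (restrict_space borel T) (rho_bar T)"

text \<open>A function on \<open>T\<close> is represented by its extension by \<open>0\<close> to the real line; continuity is
  that on the subspace \<open>T\<close>.\<close>

definition C_space :: "real set \<Rightarrow> (real \<Rightarrow> real) set"
  where "C_space T = {\<omega>. continuous_on T \<omega> \<and> \<omega> 0 = 0 \<and> (\<forall>t. t \<notin> T \<longrightarrow> \<omega> t = 0)}"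

definition sup_norm :: "real set \<Rightarrow> (real \<Rightarrow> real) \<Rightarrow> real"
  where "sup_norm T \<omega> = (SUP t\<in>T. \<bar>\<omega> t\<bar>)"

definition sampled_wiener_measure ::
    "real set \<Rightarrow> 'w measure \<Rightarrow> (real \<Rightarrow> 'w \<Rightarrow> real) \<Rightarrow> (real \<Rightarrow> real) measure"
  where "sampled_wiener_measure T M B =
    distr M (norm_borel (C_space T) (sup_norm T)) (\<lambda>w t. if t \<in> T then B t w else 0)"

definition is_delta_derivative :: "real set \<Rightarrow> (real \<Rightarrow> real) \<Rightarrow> (real \<Rightarrow> real) \<Rightarrow> bool"
  where "is_delta_derivative T h f \<longleftrightarrow>
    f \<in> borel_measurable (lambda_Delta T) \<and>
    integrable (lambda_Delta T) (\<lambda>s. (f s)\<^sup>2) \<and>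
    (\<forall>t\<in>T. h t = (LINT s:{0..<t} \<inter> T|lambda_Delta T. f s))"

definition H_space :: "real set \<Rightarrow> (real \<Rightarrow> real) set"
  where "H_space T = {h \<in> C_space T. \<exists>f. is_delta_derivative T h f}"

text \<open>The derivative is unique only up to null sets, since \<open>{0..<t} \<inter> T\<close> for \<open>t \<in> T\<close> generate the
  Borel sets of \<open>T - {1}\<close> and \<open>{1}\<close> is null. The integral in the inner product does not depend on
  the choice.\<close>

definition delta_derivative :: "real set \<Rightarrow> (real \<Rightarrow> real) \<Rightarrow> real \<Rightarrow> real"
  where "delta_derivative T h = (SOME f. is_delta_derivative T h f)"

definition H_inner :: "real set \<Rightarrow> (real \<Rightarrow> real) \<Rightarrow> (real \<Rightarrow> real) \<Rightarrow> real"
  where "H_inner T h k =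
    (LINT s|lambda_Delta T. delta_derivative T h s * delta_derivative T k s)"

end

theory Submission
  imports Defs
begin

text \<open>
  A function in \<open>H_space T\<close> is recovered from its values by the kernels \<open>s \<mapsto> min s t\<close>, whose
  delta derivatives are the indicators of \<open>{0..<t} \<inter> T\<close>: the inner product with such a kernel is
  evaluation at \<open>t\<close>. Hence \<open>H_space T\<close>, complete by the Riesz--Fischer argument, is separable, because
  the rational combinations of kernels at a countable dense set of times are dense.

  Interpolating \<open>\<omega>\<close> linearly between the points of a grid in \<open>T\<close> gives a combination of kernels, and
  along suitable grids these interpolations converge uniformly to \<open>\<omega>\<close>; this yields density and
  separability of \<open>C_space T\<close>. For a functional \<open>l\<close> with Riesz representative \<open>k\<close>, \<open>l\<close> of the
  interpolation of a Brownian path is a combination of independent Gaussian increments whose variance is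
  \<open>l\<close> of the interpolation of \<open>k\<close>. In the limit the variance is \<open>l k\<close>, the squared norm of \<open>k\<close>.
\<close>

section \<open>Normed and inner product spaces on a carrier\<close>

text \<open>\<open>T\<close> may mix intervals, Cantor-like pieces and isolated points, so
  \<open>lambda_Delta T\<close> can have both atoms and a diffuse part. No case distinction arises:
  besides its Borel sets and total mass, this measure enters only through the mass \<open>t\<close>
  of \<open>{0..<t} \<inter> T\<close> for \<open>t \<in> T\<close>. That identity gives the
  derivatives of the kernels, the Hoelder bound on primitives and the uniqueness of derivatives.

  Gaps of \<open>T\<close> rule out grids of uniformly small mesh, so a grid may jump across a gap
  of any length.

  The variance is found without representing \<open>l\<close> by a measure on \<open>T\<close>.
  Since \<open>l\<close> sends the kernel at \<open>t\<close> to \<open>k t\<close>, it sends the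
  interpolation of any \<open>\<omega>\<close> to the sum of (slope of \<open>k\<close>) *
  (increment of \<open>\<omega>\<close>) over the steps. For a Brownian path this is Gaussian with
  variance the sum of (slope of \<open>k\<close>)^2 * (step length), and for
  \<open>\<omega> = k\<close> the sum is exactly that number.

  The target locales assume completeness and separability. The weaker locales
  \<open>normed_on\<close> and \<open>inner_product_on\<close> supply the metric tools with which
  these two properties are then proved.\<close>

locale normed_on =
  fixes V :: "'a::real_vector set" and N :: "'a \<Rightarrow> real"
  assumes subspace_carrier: "subspace V"
    and norm_nonneg: "x \<in> V \<Longrightarrow> 0 \<le> N x"
    and norm_eq_0_iff: "x \<in> V \<Longrightarrow> N x = 0 \<longleftrightarrow> x = 0"
    and norm_scaleR: "x \<in> V \<Longrightarrow> N (c *\<^sub>R x) = \<bar>c\<bar> * N x"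
    and norm_triangle: "x \<in> V \<Longrightarrow> y \<in> V \<Longrightarrow> N (x + y) \<le> N x + N y"
begin

lemma zero_mem: "0 \<in> V"
  and add_mem: "x \<in> V \<Longrightarrow> y \<in> V \<Longrightarrow> x + y \<in> V"
  and diff_mem: "x \<in> V \<Longrightarrow> y \<in> V \<Longrightarrow> x - y \<in> V"
  and scaleR_mem: "x \<in> V \<Longrightarrow> c *\<^sub>R x \<in> V"
  and sum_mem: "(\<And>i. i \<in> I \<Longrightarrow> f i \<in> V) \<Longrightarrow> sum f I \<in> V"
  using subspace_carrier
  by (auto simp: subspace_0 subspace_add subspace_diff subspace_scale subspace_sum)

lemma norm_minus_commute: "x \<in> V \<Longrightarrow> y \<in> V \<Longrightarrow> N (x - y) = N (y - x)"
  using norm_scaleR[of "x - y" "-1"] diff_mem by simp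

sublocale Metric_space V "norm_dist V N"
proof
  fix x y z assume xyz: "x \<in> V" "y \<in> V" "z \<in> V"
  then show "norm_dist V N x z \<le> norm_dist V N x y + norm_dist V N y z"
    using norm_triangle[of "x - y" "y - z"] by (simp add: norm_dist_def diff_mem)
qed (auto simp: norm_dist_def norm_nonneg norm_minus_commute norm_eq_0_iff diff_mem)

lemma mtopology_eq: "norm_topology V N = mtopology"
  by (simp add: norm_topology_def)

lemma topspace_norm_topology: "topspace (norm_topology V N) = V"
  by (simp add: mtopology_eq)

lemma limitin_norm_topology:
  assumes "\<And>n. x n \<in> V"
  shows "limitin (norm_topology V N) x l sequentially \<longleftrightarrow> l \<in> V \<and> (\<lambda>n. N (x n - l)) \<longlonglongrightarrow> 0"
  unfolding mtopology_eq limitin_metric_dist_null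
  using assms by (auto simp: norm_dist_def)

lemma mcompleteI:
  assumes "\<And>x. (\<And>n. x n \<in> V) \<Longrightarrow>
      (\<And>e. e > 0 \<Longrightarrow> \<exists>n0. \<forall>m\<ge>n0. \<forall>n\<ge>n0. N (x m - x n) < e) \<Longrightarrow>
      \<exists>l\<in>V. (\<lambda>n. N (x n - l)) \<longlonglongrightarrow> 0"
  shows mcomplete
  unfolding mcomplete_def
proof (intro allI impI)
  fix x :: "nat \<Rightarrow> 'a" assume "MCauchy x"
  then have x: "x n \<in> V" for n
    by (auto simp: MCauchy_def)
  have "\<exists>n0. \<forall>m\<ge>n0. \<forall>n\<ge>n0. N (x m - x n) < e" if "e > 0" for e
  proof -
    obtain n0 where "\<forall>m n. n0 \<le> m \<longrightarrow> n0 \<le> n \<longrightarrow> norm_dist V N (x m) (x n) < e"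
      using \<open>MCauchy x\<close> \<open>e > 0\<close> unfolding MCauchy_def by blast
    then show ?thesis
      using x by (intro exI[of _ n0]) (simp add: norm_dist_def)
  qed
  then obtain l where "l \<in> V" "(\<lambda>n. N (x n - l)) \<longlonglongrightarrow> 0"
    using assms x by blast
  then have "limitin mtopology x l sequentially"
    unfolding mtopology_eq[symmetric] by (intro limitin_norm_topology[THEN iffD2] x) simp
  then show "\<exists>l. limitin mtopology x l sequentially" ..
qed

lemma closure_of_eq_carrier_iff:
  assumes "D \<subseteq> V"
  shows "norm_topology V N closure_of D = V \<longleftrightarrow> (\<forall>x\<in>V. \<forall>e>0. \<exists>d\<in>D. N (x - d) < e)"
proof -
  have "norm_topology V N closure_of D = {x \<in> V. \<forall>e>0. \<exists>d\<in>D. N (x - d) < e}"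
    unfolding mtopology_eq metric_closure_of in_mball norm_dist_def
    using assms by (intro Collect_cong) (smt (verit, best) subset_iff)
  then show ?thesis by (simp add: set_eq_iff) blast
qed

lemma separable_space_iff:
  "separable_space (norm_topology V N) \<longleftrightarrow>
    (\<exists>D\<subseteq>V. countable D \<and> (\<forall>x\<in>V. \<forall>e>0. \<exists>d\<in>D. N (x - d) < e))"
  unfolding separable_space_def topspace_norm_topology
  using closure_of_eq_carrier_iff by blast

lemma dual_on_linear:
  assumes "l \<in> dual_on V N" and "x \<in> V" and "y \<in> V"
  shows "l (x + y) = l x + l y" and "l (c *\<^sub>R x) = c * l x" and "l (x - y) = l x - l y"
proof -
  have *: "l (x + y) = l x + l y" "l (c *\<^sub>R x) = c * l x" if "x \<in> V" "y \<in> V" for c x y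
    using that assms(1) by (auto simp: dual_on_def linear_between_def)
  show "l (x + y) = l x + l y" "l (c *\<^sub>R x) = c * l x"
    using * assms by auto
  show "l (x - y) = l x - l y"
    using *(1)[of x "- 1 *\<^sub>R y"] *(2)[of y y "-1"] scaleR_mem[of y "-1"] assms by simp
qed

lemma dual_on_sum:
  assumes "l \<in> dual_on V N" and "\<And>i. i \<in> I \<Longrightarrow> f i \<in> V"
  shows "l (sum f I) = (\<Sum>i\<in>I. l (f i))"
  using assms(2)
proof (induction I rule: infinite_finite_induct)
  case (insert i I)
  then show ?case
    using dual_on_linear(1)[OF assms(1)] sum_mem[of I f] by simp
qed (use dual_on_linear(2)[OF assms(1) zero_mem zero_mem, of 0] in auto)

lemma dual_on_tendsto:
  assumes "l \<in> dual_on V N" and "\<And>n. x n \<in> V" and "y \<in> V" and "(\<lambda>n. N (x n - y)) \<longlonglongrightarrow> 0"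
  shows "(\<lambda>n. l (x n)) \<longlonglongrightarrow> l y"
proof -
  have "limitin (norm_topology V N) x y sequentially"
    using assms limitin_norm_topology by blast
  moreover have "continuous_map (norm_topology V N) euclideanreal l"
    using assms(1) by (simp add: dual_on_def)
  ultimately have "limitin euclideanreal (l \<circ> x) (l y) sequentially"
    by (rule continuous_map_limit[rotated])
  then show ?thesis by (simp add: comp_def)
qed

text \<open>Continuity at \<open>0\<close> suffices: some ball of radius \<open>r\<close> is mapped
  into the interval from \<open>-1\<close> to \<open>1\<close>, and every nonzero \<open>x\<close>
  can be rescaled to norm \<open>r / 2\<close> inside that ball. This is the origin of the constant
  \<open>2 / r\<close>.\<close>

lemma dual_on_bounded:
  assumes "l \<in> dual_on V N"
  obtains C where "C \<ge> 0" and "\<And>x. x \<in> V \<Longrightarrow> \<bar>l x\<bar> \<le> C * N x"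
proof -
  have l0: "l 0 = 0"
    using dual_on_linear(2)[OF assms zero_mem zero_mem, of 0] by simp
  have "openin mtopology {x \<in> V. l x \<in> {-1<..<1}}"
    using assms openin_continuous_map_preimage[of mtopology euclideanreal l "{-1<..<1}"]
    by (simp add: dual_on_def mtopology_eq)
  moreover have "0 \<in> {x \<in> V. l x \<in> {-1<..<1}}"
    using zero_mem l0 by simp
  ultimately obtain r where r: "r > 0" "mball 0 r \<subseteq> {x \<in> V. l x \<in> {-1<..<1}}"
    unfolding openin_mtopology by blast
  have "\<bar>l x\<bar> \<le> 2 / r * N x" if x: "x \<in> V" for x
  proof (cases "x = 0")
    case False
    then have pos: "N x > 0"
      using x norm_nonneg norm_eq_0_iff by (metis less_eq_real_def)
    define c where "c = r / (2 * N x)"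
    have c: "c > 0" using pos r by (simp add: c_def)
    have "norm_dist V N 0 (c *\<^sub>R x) = N (c *\<^sub>R x)"
      using x zero_mem scaleR_mem norm_minus_commute[of 0 "c *\<^sub>R x"] by (simp add: norm_dist_def)
    also have "\<dots> = r / 2"
      using x pos r by (simp add: norm_scaleR c_def)
    finally have "c *\<^sub>R x \<in> mball 0 r"
      using x zero_mem scaleR_mem r by simp
    then have "\<bar>l (c *\<^sub>R x)\<bar> < 1"
      using r by (auto simp: abs_less_iff)
    then have "c * \<bar>l x\<bar> < 1"
      using dual_on_linear(2)[OF assms x x] c by (simp add: abs_mult)
    then show ?thesis
      using pos r by (simp add: c_def field_simps)
  qed (use r norm_nonneg zero_mem l0 in simp)
  then show thesis
    using that[of "2 / r"] r by auto
qed

section \<open>Borel sets of the norm topology and measurability\<close>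

lemma space_norm_borel: "space (norm_borel V N) = V"
  unfolding norm_borel_def using openin_subset[of "norm_topology V N"] topspace_norm_topology
  by (intro space_measure_of) auto

lemma dual_on_measurable:
  assumes "l \<in> dual_on V N"
  shows "l \<in> borel_measurable (norm_borel V N)"
proof (rule borel_measurableI)
  fix S :: "real set" assume "open S"
  have sub: "{U. openin (norm_topology V N) U} \<subseteq> Pow V"
    using openin_subset[of "norm_topology V N"] topspace_norm_topology by auto
  have "openin (norm_topology V N) {x \<in> V. l x \<in> S}"
    using assms \<open>open S\<close> openin_continuous_map_preimage[of "norm_topology V N" euclideanreal l S]
    by (simp add: dual_on_def topspace_norm_topology)
  moreover have "l -` S \<inter> space (norm_borel V N) = {x \<in> V. l x \<in> S}"
    by (auto simp: space_norm_borel)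
  ultimately show "l -` S \<inter> space (norm_borel V N) \<in> sets (norm_borel V N)"
    using sub by (simp add: norm_borel_def)
qed

text \<open>In a separable space every open set is a countable union of balls with centres in a
  countable dense set.\<close>

lemma measurable_norm_borel:
  assumes "separable_space (norm_topology V N)" and "f \<in> space M \<rightarrow> V"
    and balls: "\<And>d r. d \<in> V \<Longrightarrow> {w \<in> space M. N (f w - d) \<le> r} \<in> sets M"
  shows "f \<in> measurable M (norm_borel V N)"
proof -
  obtain D where D: "D \<subseteq> V" "countable D" and dense: "\<And>x e. x \<in> V \<Longrightarrow> e > 0 \<Longrightarrow> \<exists>d\<in>D. N (x - d) < e"
    using assms(1) by (auto simp: separable_space_iff)
  have sub: "{U. openin (norm_topology V N) U} \<subseteq> Pow V"
    using openin_subset[of "norm_topology V N"] topspace_norm_topology by auto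
  have "f -` U \<inter> space M \<in> sets M" if U: "openin (norm_topology V N) U" for U
  proof -
    \<comment> \<open>Closed balls, because the hypothesis \<open>balls\<close> provides the
      preimages of closed balls; rational radii keep the index set countable.\<close>
    define I where "I = {(d, q) \<in> D \<times> \<rat>. {y \<in> V. N (y - d) \<le> q} \<subseteq> U}"
    have "countable I"
      unfolding I_def using D countable_rat by (intro countable_subset[OF _ countable_SIGMA]) auto
    have "\<exists>(d, q)\<in>I. N (y - d) \<le> q" if "y \<in> U" for y
    proof -
      have y: "y \<in> V" using U \<open>y \<in> U\<close> sub by auto
      obtain r where r: "r > 0" "mball y r \<subseteq> U"
        using U \<open>y \<in> U\<close> by (auto simp: mtopology_eq openin_mtopology)
      \<comment> \<open>The centre \<open>d\<close> will be within \<open>q\<close> of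
        \<open>y\<close>, so the closed ball of radius \<open>q\<close> at \<open>d\<close> stays
        within \<open>2 * q < r\<close> of \<open>y\<close>.\<close>
      obtain q where q: "q \<in> \<rat>" "0 < q" "q < r / 2"
        using Rats_dense_in_real[of 0 "r / 2"] r by auto
      obtain d where d: "d \<in> D" "N (y - d) < q"
        using dense y q by blast
      have "{z \<in> V. N (z - d) \<le> q} \<subseteq> U"
      proof safe
        fix z assume z: "z \<in> V" "N (z - d) \<le> q"
        have "d \<in> V" using d D by auto
        then have "N (y - z) \<le> N (y - d) + N (z - d)"
          using norm_triangle[of "y - d" "d - z"] y z norm_minus_commute[of d z]
          by (simp add: diff_mem)
        then have "z \<in> mball y r"
          using y z d q by (simp add: norm_dist_def)
        then show "z \<in> U" using r by auto
      qed
      then show ?thesis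
        using d q unfolding I_def by force
    qed
    then have "f -` U \<inter> space M = (\<Union>(d, q)\<in>I. {w \<in> space M. N (f w - d) \<le> q})"
      using assms(2) by (fastforce simp: I_def)
    also have "\<dots> \<in> sets M"
      using \<open>countable I\<close> D balls by (intro sets.countable_UN') (auto simp: I_def)
    finally show ?thesis .
  qed
  then show ?thesis
    unfolding norm_borel_def using sub assms(2) by (intro measurable_measure_of) auto
qed

end

lemma bounded_embedding_continuous:
  assumes "normed_on V N" and "normed_on W N'" and "V \<subseteq> W"
    and "\<And>x. x \<in> V \<Longrightarrow> N' x \<le> N x"
  shows "continuous_map (norm_topology V N) (norm_topology W N') (\<lambda>x. x)"
proof -
  interpret V: normed_on V N by fact
  interpret W: normed_on W N' by fact
  have "N' (x - y) < e" if "x \<in> V" "y \<in> V" "N (x - y) < e" for x y e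
    using that assms(4)[of "x - y"] V.diff_mem[of x y] by simp
  then show ?thesis
    unfolding V.mtopology_eq W.mtopology_eq
    using assms(3) by (subst V.metric_continuous_map[OF W.Metric_space_axioms])
      (auto simp: norm_dist_def subset_iff)
qed

locale inner_product_on =
  fixes V :: "'a::real_vector set" and ip :: "'a \<Rightarrow> 'a \<Rightarrow> real"
  assumes subspace_carrier: "subspace V"
    and inner_commute: "x \<in> V \<Longrightarrow> y \<in> V \<Longrightarrow> ip x y = ip y x"
    and inner_add_left: "x \<in> V \<Longrightarrow> y \<in> V \<Longrightarrow> z \<in> V \<Longrightarrow> ip (x + y) z = ip x z + ip y z"
    and inner_scaleR_left: "x \<in> V \<Longrightarrow> y \<in> V \<Longrightarrow> ip (c *\<^sub>R x) y = c * ip x y"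
    and inner_nonneg: "x \<in> V \<Longrightarrow> 0 \<le> ip x x"
    and inner_eq_0_iff: "x \<in> V \<Longrightarrow> ip x x = 0 \<longleftrightarrow> x = 0"
begin

lemma inner_add_right: "x \<in> V \<Longrightarrow> y \<in> V \<Longrightarrow> z \<in> V \<Longrightarrow> ip z (x + y) = ip z x + ip z y"
  using inner_add_left inner_commute subspace_add[OF subspace_carrier] by metis

lemma inner_scaleR_right: "x \<in> V \<Longrightarrow> y \<in> V \<Longrightarrow> ip y (c *\<^sub>R x) = c * ip y x"
  using inner_scaleR_left inner_commute subspace_scale[OF subspace_carrier] by metis

lemma inner_norm_power2: "x \<in> V \<Longrightarrow> (inner_norm ip x)\<^sup>2 = ip x x"
  by (simp add: inner_norm_def inner_nonneg)

lemma inner_diff_left: "x \<in> V \<Longrightarrow> y \<in> V \<Longrightarrow> z \<in> V \<Longrightarrow> ip (x - y) z = ip x z - ip y z"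
  using inner_add_left[of x "-1 *\<^sub>R y" z] inner_scaleR_left[of y z "-1"]
    subspace_scale[OF subspace_carrier, of y "-1"] by simp



text \<open>The one expansion behind Cauchy-Schwarz, the triangle inequality (\<open>c = 1\<close>),
  the parallelogram law (\<open>c = 1\<close> and \<open>c = -1\<close>) and the first variation in
  \<open>bounded_functional_represented\<close>.\<close>

lemma inner_add_scaleR_self:
  assumes "x \<in> V" "y \<in> V"
  shows "ip (x + c *\<^sub>R y) (x + c *\<^sub>R y) = ip x x + 2 * c * ip x y + c\<^sup>2 * ip y y"
  using assms subspace_add[OF subspace_carrier] subspace_scale[OF subspace_carrier]
  by (simp add: inner_add_left inner_add_right inner_scaleR_left inner_scaleR_right
      inner_commute[of y x] power2_eq_square algebra_simps)

lemma Cauchy_Schwarz: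
  assumes "x \<in> V" "y \<in> V"
  shows "\<bar>ip x y\<bar> \<le> inner_norm ip x * inner_norm ip y"
proof (cases "y = 0")
  case True
  have "ip x (0 *\<^sub>R y) = 0 * ip x y"
    using assms by (rule inner_scaleR_right[rotated])
  then show ?thesis
    using True assms by (simp add: inner_norm_def inner_nonneg)
next
  case False
  then have pos: "ip y y > 0"
    using assms inner_nonneg[of y] inner_eq_0_iff[of y] by simp
  \<comment> \<open>This scalar minimises the quadratic polynomial of
    \<open>inner_add_scaleR_self\<close>.\<close>
  have "0 \<le> ip (x + (- ip x y / ip y y) *\<^sub>R y) (x + (- ip x y / ip y y) *\<^sub>R y)"
    using assms by (intro inner_nonneg subspace_add subspace_scale subspace_carrier)
  also have "\<dots> = ip x x - (ip x y)\<^sup>2 / ip y y"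
    using pos by (subst inner_add_scaleR_self[OF assms]) (simp add: power2_eq_square)
  finally have "(ip x y)\<^sup>2 \<le> ip x x * ip y y"
    using pos by (simp add: field_simps)
  then have "sqrt ((ip x y)\<^sup>2) \<le> sqrt (ip x x * ip y y)"
    by (rule real_sqrt_le_mono)
  then show ?thesis
    by (simp add: inner_norm_def real_sqrt_mult)
qed

sublocale normed_on V "inner_norm ip"
proof
  fix x y assume xy: "x \<in> V" "y \<in> V"
  have "ip (x + y) (x + y) = ip x x + 2 * ip x y + ip y y"
    using inner_add_scaleR_self[OF xy, of 1] by simp
  also have "\<dots> \<le> (inner_norm ip x + inner_norm ip y)\<^sup>2"
    using Cauchy_Schwarz[OF xy] inner_norm_power2[OF xy(1)] inner_norm_power2[OF xy(2)]
    by (simp add: power2_sum)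
  finally have "sqrt (ip (x + y) (x + y)) \<le> sqrt ((inner_norm ip x + inner_norm ip y)\<^sup>2)"
    by (rule real_sqrt_le_mono)
  then show "inner_norm ip (x + y) \<le> inner_norm ip x + inner_norm ip y"
    using xy by (simp add: inner_norm_def inner_nonneg)
next
  fix x :: 'a and c :: real assume "x \<in> V"
  then have "ip (c *\<^sub>R x) (c *\<^sub>R x) = c\<^sup>2 * ip x x"
    by (simp add: inner_scaleR_left inner_scaleR_right subspace_scale[OF subspace_carrier]
        power2_eq_square)
  then show "inner_norm ip (c *\<^sub>R x) = \<bar>c\<bar> * inner_norm ip x"
    by (simp add: inner_norm_def real_sqrt_mult)
qed (auto simp: subspace_carrier inner_norm_def inner_nonneg inner_eq_0_iff)

section \<open>Minimization, Riesz representation and totality\<close>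

lemma parallelogram:
  assumes "x \<in> V" "y \<in> V"
  shows "ip (x - y) (x - y) + ip (x + y) (x + y) = 2 * ip x x + 2 * ip y y"
  using inner_add_scaleR_self[OF assms, of 1] inner_add_scaleR_self[OF assms, of "-1"] by simp

text \<open>A minimizing sequence of \<open>ip x x - 2 * l x\<close> on \<open>W\<close> is Cauchy by the parallelogram law.
  For \<open>W = V\<close> this is the Riesz representation theorem; for \<open>l = ip h\<close> the limit is the orthogonal
  projection of \<open>h\<close> to the closure of \<open>W\<close>. Rational scalars suffice and allow \<open>W\<close> countable.\<close>

lemma bounded_functional_represented:
  fixes W :: "'a set" and l :: "'a \<Rightarrow> real"
  assumes mcomplete and "W \<subseteq> V" and "0 \<in> W"
    and W_add: "\<And>x y. x \<in> W \<Longrightarrow> y \<in> W \<Longrightarrow> x + y \<in> W"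
    and W_scaleR: "\<And>q x. q \<in> \<rat> \<Longrightarrow> x \<in> W \<Longrightarrow> q *\<^sub>R x \<in> W"
    and l_add: "\<And>x y. x \<in> W \<Longrightarrow> y \<in> W \<Longrightarrow> l (x + y) = l x + l y"
    and l_scaleR: "\<And>q x. q \<in> \<rat> \<Longrightarrow> x \<in> W \<Longrightarrow> l (q *\<^sub>R x) = q * l x"
    and l_bounded: "\<And>x. x \<in> W \<Longrightarrow> \<bar>l x\<bar> \<le> C * inner_norm ip x"
  shows "\<exists>p\<in>V. (\<forall>w\<in>W. ip p w = l w) \<and> (\<forall>e>0. \<exists>w\<in>W. inner_norm ip (p - w) < e)"
proof -
  let ?n = "inner_norm ip"
  define F where "F x = ip x x - 2 * l x" for x
  \<comment> \<open>The bound on \<open>l\<close> gives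
    \<open>F x \<ge> (?n x)^2 - 2 * C * ?n x\<close>, which is
    \<open>(?n x - C)^2 - C^2\<close>.\<close>
  have F_ge: "F x \<ge> - C\<^sup>2" if "x \<in> W" for x
  proof -
    have "0 \<le> (?n x - C)\<^sup>2" by simp
    then show ?thesis
      using l_bounded[OF that] inner_norm_power2[of x] that assms(2)
      by (auto simp: F_def power2_diff mult.commute[of C])
  qed
  define m where "m = (INF x\<in>W. F x)"
  have bdd: "bdd_below (F ` W)"
    using F_ge by (intro bdd_belowI2) auto
  have m_le: "m \<le> F x" if "x \<in> W" for x
    unfolding m_def using bdd that by (rule cINF_lower)
  have "\<exists>x\<in>W. F x < m + 1 / Suc n" for n
    using cINF_less_iff[of W F "m + 1 / Suc n"] bdd assms(3) by (auto simp: m_def[symmetric])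
  then obtain x where xW: "\<And>n. x n \<in> W" and Fx: "\<And>n. F (x n) < m + 1 / Suc n"
    by metis
  have xV: "x n \<in> V" for n using xW assms(2) by auto
  \<comment> \<open>The midpoint of \<open>x i\<close> and \<open>x j\<close> lies in
    \<open>W\<close>, so \<open>F\<close> is at least \<open>m\<close> there; the parallelogram law
    converts the near-minimality of both points into closeness.\<close>
  have gap: "(?n (x i - x j))\<^sup>2 \<le> 2 / Suc i + 2 / Suc j" for i j
  proof -
    define z where "z = (1/2) *\<^sub>R (x i + x j)"
    have z: "z \<in> W" unfolding z_def using xW W_add by (intro W_scaleR) auto
    have 1: "ip z z = (1/4) * ip (x i + x j) (x i + x j)"
      unfolding z_def using xV[of i] xV[of j]
      by (simp add: inner_scaleR_left inner_scaleR_right add_mem scaleR_mem)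
    have 2: "l z = (1/2) * (l (x i) + l (x j))"
      unfolding z_def using xW[of i] xW[of j] W_add l_add l_scaleR[of "1/2"] by simp
    have "m \<le> F z" using z by (rule m_le)
    then have "ip (x i - x j) (x i - x j) \<le> 2 * F (x i) + 2 * F (x j) - 4 * m"
      using parallelogram[OF xV[of i] xV[of j]] unfolding F_def 1 2 by argo
    then show ?thesis
      using Fx[of i] Fx[of j] inner_norm_power2[of "x i - x j"] xV by (simp add: diff_mem)
  qed
  have "MCauchy x"
    unfolding MCauchy_def
  proof safe
    fix e :: real assume "e > 0"
    \<comment> \<open>From index \<open>n0\<close> on, \<open>gap\<close> bounds the squared
      distance by \<open>4 / Suc n0\<close>.\<close>
    obtain n0 where n0: "4 / e\<^sup>2 < Suc n0"
      using reals_Archimedean2 less_trans of_nat_less_iff lessI by metis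
    have "?n (x i - x j) < e" if "i \<ge> n0" "j \<ge> n0" for i j
    proof -
      have "2 / Suc i + 2 / Suc j \<le> 2 / Suc n0 + 2 / real (Suc n0)"
        using that by (intro add_mono divide_left_mono) auto
      also have "\<dots> = 4 / real (Suc n0)"
        by (simp flip: add_divide_distrib)
      also have "\<dots> < e\<^sup>2"
        using n0 \<open>e > 0\<close> by (simp add: field_simps)
      finally have "(?n (x i - x j))\<^sup>2 < e\<^sup>2"
        using gap[of i j] by linarith
      then show ?thesis
        using \<open>e > 0\<close> by (simp add: power_less_imp_less_base)
    qed
    then show "\<exists>n0. \<forall>n n'. n0 \<le> n \<longrightarrow> n0 \<le> n' \<longrightarrow> norm_dist V ?n (x n) (x n') < e"
      using xV by (auto simp: norm_dist_def)
  qed (use xV in auto)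
  then obtain p where "limitin mtopology x p sequentially"
    using assms(1) by (auto simp: mcomplete_def)
  then have p: "p \<in> V" and lim: "(\<lambda>n. ?n (x n - p)) \<longlonglongrightarrow> 0"
    using limitin_norm_topology[OF xV] by (auto simp: mtopology_eq)
  have "ip p w = l w" if w: "w \<in> W" for w
  proof -
    have wV: "w \<in> V" using w assms(2) by auto
    have lim_ip: "(\<lambda>n. ip (x n) w) \<longlonglongrightarrow> ip p w"
    proof (rule Lim_transform[OF tendsto_const])
      have "(\<lambda>n. ?n (x n - p) * ?n w) \<longlonglongrightarrow> 0"
        using tendsto_mult_left_zero[OF lim] by simp
      then have "(\<lambda>n. ip (x n - p) w) \<longlonglongrightarrow> 0"
        by (rule Lim_null_comparison[rotated]) (simp add: Cauchy_Schwarz diff_mem xV p wV)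
      then show "(\<lambda>n. ip (x n) w - ip p w) \<longlonglongrightarrow> 0"
        by (simp add: inner_diff_left[OF xV p wV])
    qed
    \<comment> \<open>First variation in direction \<open>w\<close>:
      \<open>F (x n + q *\<^sub>R w)\<close> is at least \<open>m\<close>, and
      \<open>F (x n)\<close> exceeds \<open>m\<close> by less than \<open>1 / Suc n\<close>. The
      limit is taken only in \<open>ip (x n) w\<close>, because \<open>p\<close> may lie outside
      \<open>W\<close>, where nothing is assumed about \<open>l\<close>.\<close>
    have quad: "0 \<le> 2 * q * (ip p w - l w) + q\<^sup>2 * ip w w" if q: "q \<in> \<rat>" for q
    proof -
      have "0 \<le> 1 / Suc n + (2 * q * (ip (x n) w - l w) + q\<^sup>2 * ip w w)" for n
      proof -
        have "m \<le> F (x n + q *\<^sub>R w)"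
          using xW w q by (intro m_le W_add W_scaleR)
        also have "\<dots> = F (x n) + (2 * q * (ip (x n) w - l w) + q\<^sup>2 * ip w w)"
          using l_add[OF xW W_scaleR[OF q w]] l_scaleR[OF q w] inner_add_scaleR_self[OF xV wV]
          by (simp add: F_def algebra_simps)
        finally show ?thesis using Fx[of n] by linarith
      qed
      moreover have "(\<lambda>n. 1 / Suc n + (2 * q * (ip (x n) w - l w) + q\<^sup>2 * ip w w)) \<longlonglongrightarrow>
          0 + (2 * q * (ip p w - l w) + q\<^sup>2 * ip w w)"
        by (intro tendsto_intros lim_ip LIMSEQ_Suc[OF lim_1_over_n])
      ultimately show ?thesis
        by (metis (no_types, lifting) LIMSEQ_le_const add_0)
    qed
    \<comment> \<open>Take \<open>q = s / Suc n\<close> with a sign \<open>s\<close> and divide by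
      \<open>1 / Suc n\<close>: the quadratic term then vanishes in the limit. Reciprocals of
      naturals keep \<open>q\<close> rational, and the two signs give the two inequalities that make
      up \<open>ip p w = l w\<close>.\<close>
    have half: "- ip w w / (2 * real (Suc n)) \<le> s * (ip p w - l w)" if "s \<in> {1, -1}" for s n
    proof -
      define c where "c = 1 / real (Suc n)"
      have c: "c > 0" "s * c \<in> \<rat>" "s\<^sup>2 = 1" using that by (auto simp: c_def)
      have "0 \<le> 2 * (s * c) * (ip p w - l w) + (s * c)\<^sup>2 * ip w w"
        using c by (intro quad)
      also have "\<dots> = c * (2 * (s * (ip p w - l w)) + c * ip w w)"
        using c(3) by (simp add: power_mult_distrib) (simp add: power2_eq_square algebra_simps)
      finally have "0 \<le> 2 * (s * (ip p w - l w)) + c * ip w w"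
        using c by (simp add: zero_le_mult_iff)
      then have "- (c * ip w w) / 2 \<le> s * (ip p w - l w)" by argo
      then show ?thesis by (simp add: c_def mult.commute)
    qed
    have "(\<lambda>n. - ip w w / (2 * real (Suc n))) \<longlonglongrightarrow> 0"
      using tendsto_mult_right_zero[OF LIMSEQ_Suc[OF lim_1_over_n], of "- ip w w / 2"]
      by (simp add: field_simps)
    then have "0 \<le> s * (ip p w - l w)" if "s \<in> {1, -1}" for s
      using LIMSEQ_le_const2 half[OF that] by blast
    from this[of 1] this[of "-1"] show ?thesis by simp
  qed
  moreover have "\<exists>w\<in>W. ?n (p - w) < e" if "e > 0" for e
  proof -
    obtain n where "?n (x n - p) < e"
      using order_tendstoD(2)[OF lim \<open>e > 0\<close>] by (auto simp: eventually_sequentially)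
    then show ?thesis
      using norm_minus_commute[OF p xV] by (intro bexI[OF _ xW[of n]]) simp
  qed
  ultimately show ?thesis
    using p by blast
qed

corollary Riesz_representation:
  assumes mcomplete and "l \<in> dual_on V (inner_norm ip)"
  shows "\<exists>!k. k \<in> V \<and> (\<forall>h\<in>V. ip k h = l h)"
proof -
  obtain C where C: "\<And>x. x \<in> V \<Longrightarrow> \<bar>l x\<bar> \<le> C * inner_norm ip x"
    using dual_on_bounded[OF assms(2)] by blast
  have "\<exists>p\<in>V. (\<forall>w\<in>V. ip p w = l w) \<and> (\<forall>e>0. \<exists>w\<in>V. inner_norm ip (p - w) < e)"
    using dual_on_linear[OF assms(2)]
    by (intro bounded_functional_represented[OF assms(1), of V l C] C)
      (auto simp: zero_mem add_mem scaleR_mem)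
  then obtain p where "p \<in> V" "\<forall>h\<in>V. ip p h = l h"
    by blast
  moreover have "k = k'"
    if "k \<in> V" "k' \<in> V" "\<forall>h\<in>V. ip k h = l h" "\<forall>h\<in>V. ip k' h = l h" for k k'
  proof -
    have "ip (k - k') (k - k') = 0"
      using that diff_mem[OF that(1,2)] by (simp add: inner_diff_left)
    then show ?thesis
      using inner_eq_0_iff[OF diff_mem[OF that(1,2)]] by simp
  qed
  ultimately show ?thesis
    by (metis (no_types, lifting))
qed

text \<open>The point \<open>p\<close> found for the functional \<open>ip h\<close> has the same
  inner products with \<open>W\<close> as \<open>h\<close>, so totality forces \<open>h = p\<close>;
  and \<open>p\<close> is by construction a limit of points of \<open>W\<close>.\<close>

corollary total_imp_dense:
  assumes mcomplete and "W \<subseteq> V" and "0 \<in> W"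
    and "\<And>x y. x \<in> W \<Longrightarrow> y \<in> W \<Longrightarrow> x + y \<in> W"
    and "\<And>q x. q \<in> \<rat> \<Longrightarrow> x \<in> W \<Longrightarrow> q *\<^sub>R x \<in> W"
    and total: "\<And>x. x \<in> V \<Longrightarrow> (\<And>w. w \<in> W \<Longrightarrow> ip x w = 0) \<Longrightarrow> x = 0"
    and "h \<in> V" and "e > 0"
  shows "\<exists>w\<in>W. inner_norm ip (h - w) < e"
proof -
  have "\<exists>p\<in>V. (\<forall>w\<in>W. ip p w = ip h w) \<and> (\<forall>e>0. \<exists>w\<in>W. inner_norm ip (p - w) < e)"
    using assms(2) \<open>h \<in> V\<close> Cauchy_Schwarz[OF \<open>h \<in> V\<close>]
    by (intro bounded_functional_represented[OF assms(1-5), of "ip h" "inner_norm ip h"])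
      (auto simp: inner_add_right inner_scaleR_right subset_iff)
  then obtain p where p: "p \<in> V" "\<forall>w\<in>W. ip p w = ip h w"
    and approx: "\<forall>e>0. \<exists>w\<in>W. inner_norm ip (p - w) < e"
    by blast
  have "h - p = 0"
    using p assms(2) \<open>h \<in> V\<close> by (intro total) (auto simp: inner_diff_left diff_mem subset_iff)
  then show ?thesis
    using approx \<open>e > 0\<close> by simp
qed

end

section \<open>Square integrable functions\<close>

text \<open>Functions, not classes modulo null sets: uniqueness almost everywhere is handled where
  delta derivatives are compared.\<close>

definition square_integrable :: "'a measure \<Rightarrow> ('a \<Rightarrow> real) \<Rightarrow> bool"
  where "square_integrable M f \<longleftrightarrow> f \<in> borel_measurable M \<and> integrable M (\<lambda>x. (f x)\<^sup>2)"

lemma square_integrable_measurable [measurable_dest]: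
  "square_integrable M f \<Longrightarrow> f \<in> borel_measurable M"
  by (simp add: square_integrable_def)

lemma square_integrable_mult:
  assumes "square_integrable M f" and "square_integrable M g"
  shows "integrable M (\<lambda>x. f x * g x)"
proof (rule Bochner_Integration.integrable_bound)
  show "integrable M (\<lambda>x. (f x)\<^sup>2 + (g x)\<^sup>2)"
    using assms by (simp add: square_integrable_def)
  show "(\<lambda>x. f x * g x) \<in> borel_measurable M"
    using assms by measurable
  have "\<bar>a * b\<bar> \<le> a\<^sup>2 + b\<^sup>2" for a b :: real
  proof -
    have "0 \<le> \<bar>a\<bar> * \<bar>b\<bar>" by simp
    moreover have "2 * (\<bar>a\<bar> * \<bar>b\<bar>) \<le> a\<^sup>2 + b\<^sup>2"
      using sum_squares_bound[of "\<bar>a\<bar>" "\<bar>b\<bar>"] by (simp add: mult.assoc)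
    ultimately show ?thesis
      unfolding abs_mult by linarith
  qed
  then show "AE x in M. norm (f x * g x) \<le> norm ((f x)\<^sup>2 + (g x)\<^sup>2)"
    by (intro AE_I2) (auto intro: order_trans)
qed

lemma square_integrable_scale:
  assumes "square_integrable M f"
  shows "square_integrable M (\<lambda>x. c * f x)"
  using assms by (auto simp: square_integrable_def power_mult_distrib)

lemma square_integrable_add:
  assumes "square_integrable M f" and "square_integrable M g"
  shows "square_integrable M (\<lambda>x. f x + g x)"
  using assms square_integrable_mult[OF assms]
  by (auto simp: square_integrable_def power2_sum mult.assoc)

lemma square_integrable_diff:
  assumes "square_integrable M f" and "square_integrable M g"
  shows "square_integrable M (\<lambda>x. f x - g x)"
  using square_integrable_add[OF assms(1) square_integrable_scale[OF assms(2), of "-1"]] by simp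

lemma square_integrable_indicator:
  assumes "A \<in> sets M" and "emeasure M A < \<infinity>"
  shows "square_integrable M (indicator A)"
proof -
  have "(\<lambda>x. (indicator A x :: real)\<^sup>2) = indicator A"
    by (auto simp: indicator_def fun_eq_iff)
  then show ?thesis
    using assms by (simp add: square_integrable_def)
qed

lemma (in finite_measure) square_integrable_imp_integrable:
  assumes "square_integrable M f"
  shows "integrable M f"
  using square_integrable_mult[OF assms, of "\<lambda>_. 1"] by (simp add: square_integrable_def)

text \<open>On functions the form is only semidefinite, so this is not an instance of
  \<open>inner_product_on\<close>: \<open>b = 0\<close> does not make \<open>g\<close> vanish
  everywhere. Nonnegativity of a quadratic polynomial in \<open>t\<close> is used instead.\<close>

lemma integral_Cauchy_Schwarz:
  assumes "square_integrable M f" and "square_integrable M g"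
  shows "\<bar>LINT x|M. f x * g x\<bar> \<le> sqrt (LINT x|M. (f x)\<^sup>2) * sqrt (LINT x|M. (g x)\<^sup>2)"
proof -
  define a b c where "a = (LINT x|M. (f x)\<^sup>2)" and "b = (LINT x|M. (g x)\<^sup>2)"
    and "c = (LINT x|M. f x * g x)"
  have nonneg: "a \<ge> 0" "b \<ge> 0"
    by (simp_all add: a_def b_def integral_nonneg_AE)
  have quad: "0 \<le> a - 2 * t * c + t\<^sup>2 * b" for t
  proof -
    have "0 \<le> (LINT x|M. (f x - t * g x)\<^sup>2)"
      by (intro integral_nonneg_AE) auto
    also have "\<dots> = (LINT x|M. (f x)\<^sup>2 - 2 * t * (f x * g x) + t\<^sup>2 * (g x)\<^sup>2)"
      by (intro Bochner_Integration.integral_cong refl)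
        (simp add: power2_diff power_mult_distrib algebra_simps)
    also have "\<dots> = a - 2 * t * c + t\<^sup>2 * b"
      using assms square_integrable_mult[OF assms]
      by (simp add: a_def b_def c_def square_integrable_def)
    finally show ?thesis .
  qed
  have "c\<^sup>2 \<le> a * b"
  proof (cases "b = 0")
    case True
    have "c = 0"
    proof (rule ccontr)
      assume "c \<noteq> 0"
      then show False
        \<comment> \<open>For \<open>b = 0\<close> the polynomial is affine in \<open>t\<close> and
          takes the value \<open>-1\<close> at this point.\<close>
        using quad[of "(a + 1) / (2 * c)"] True by simp
    qed
    then show ?thesis using nonneg by simp
  next
    case False
    then have b: "b > 0" using nonneg by simp
    have "a - 2 * (c / b) * c + (c / b)\<^sup>2 * b = a - c\<^sup>2 / b"
      using b by (simp add: power2_eq_square field_simps)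
    then have "c\<^sup>2 / b \<le> a"
      using quad[of "c / b"] by linarith
    then show ?thesis
      using b by (simp add: pos_divide_le_eq)
  qed
  then have "sqrt (c\<^sup>2) \<le> sqrt (a * b)"
    by (rule real_sqrt_le_mono)
  then show ?thesis
    by (simp add: a_def b_def c_def real_sqrt_mult)
qed

lemma (in finite_measure) integral_abs_le_sqrt:
  assumes "square_integrable M f"
  shows "(LINT x|M. \<bar>f x\<bar>) \<le> sqrt (measure M (space M)) * sqrt (LINT x|M. (f x)\<^sup>2)"
  using integral_Cauchy_Schwarz[of M "\<lambda>x. \<bar>f x\<bar>" "\<lambda>_. 1"] assms
  by (simp add: square_integrable_def mult.commute)

text \<open>Riesz--Fischer: a rapidly Cauchy subsequence converges almost everywhere, and Fatou's lemma
  turns this into convergence in mean square.\<close>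

lemma (in finite_measure) square_integrable_complete:
  fixes f :: "nat \<Rightarrow> 'a \<Rightarrow> real"
  assumes f: "\<And>n. square_integrable M (f n)"
    and Cauchy: "\<And>e. e > 0 \<Longrightarrow> \<exists>n0. \<forall>m\<ge>n0. \<forall>n\<ge>n0. (LINT x|M. (f m x - f n x)\<^sup>2) < e"
  shows "\<exists>g. square_integrable M g \<and> (\<lambda>n. LINT x|M. (f n x - g x)\<^sup>2) \<longlonglongrightarrow> 0"
proof -
  have [measurable]: "f n \<in> borel_measurable M" for n
    using f by (simp add: square_integrable_def)
  have diff_int: "integrable M (\<lambda>x. (f m x - f n x)\<^sup>2)" for m n
    using square_integrable_diff[OF f f] by (simp add: square_integrable_def)
  \<comment> \<open>The mean square bound \<open>(1/4) ^ k\<close> has square root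
    \<open>(1/2) ^ k\<close>, which makes the integrals of the absolute increments summable.\<close>
  have "\<exists>n0. \<forall>m\<ge>n0. \<forall>n\<ge>n0. (LINT x|M. (f m x - f n x)\<^sup>2) < (1/4) ^ k" for k
    by (rule Cauchy) simp
  then obtain n0 where n0: "\<And>k m n. m \<ge> n0 k \<Longrightarrow> n \<ge> n0 k \<Longrightarrow> (LINT x|M. (f m x - f n x)\<^sup>2) < (1/4) ^ k"
    by metis
  \<comment> \<open>Summing the thresholds puts \<open>s (Suc k)\<close> above \<open>n0 k\<close>
    as well, so both terms of the increment \<open>d k\<close> are past the threshold. The summand
    \<open>k\<close> drives \<open>s j\<close> beyond every \<open>n0 k\<close>.\<close>
  define s where "s k = (\<Sum>j\<le>k. n0 j) + k" for k
  have s_ge: "s k \<ge> n0 k" "s (Suc k) \<ge> n0 k" "s k \<ge> k" for k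
    unfolding s_def using member_le_sum[of k "{..k}" n0] by (auto intro: trans_le_add1)
  define d where "d k x = f (s (Suc k)) x - f (s k) x" for k x
  have d_int: "integrable M (d k)" for k
    unfolding d_def by (intro square_integrable_imp_integrable square_integrable_diff f)
  have d_le: "(LINT x|M. \<bar>d k x\<bar>) \<le> sqrt (measure M (space M)) * (1/2) ^ k" for k
  proof -
    have "(LINT x|M. \<bar>d k x\<bar>) \<le> sqrt (measure M (space M)) * sqrt (LINT x|M. (d k x)\<^sup>2)"
      unfolding d_def by (intro integral_abs_le_sqrt square_integrable_diff f)
    also have "\<dots> \<le> sqrt (measure M (space M)) * sqrt ((1/4) ^ k)"
      using n0[of k "s (Suc k)" "s k"] s_ge by (intro mult_left_mono) (auto simp: d_def)
    also have "sqrt ((1/4) ^ k) = (1/2) ^ k"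
      by (simp add: real_sqrt_power real_sqrt_divide)
    finally show ?thesis .
  qed
  have "summable (\<lambda>k. sqrt (measure M (space M)) * (1/2) ^ k)"
    by (intro summable_mult summable_geometric) simp
  then have d_summable: "summable (\<lambda>k. LINT x|M. norm (d k x))"
    by (rule summable_comparison_test'[where N=0]) (use d_le in \<open>simp add: integral_nonneg_AE\<close>)
  have "(\<integral>\<^sup>+x. (\<Sum>k. ennreal \<bar>d k x\<bar>) \<partial>M) = (\<Sum>k. \<integral>\<^sup>+x. ennreal \<bar>d k x\<bar> \<partial>M)"
    unfolding d_def by (intro nn_integral_suminf) measurable
  also have "\<dots> = (\<Sum>k. ennreal (LINT x|M. \<bar>d k x\<bar>))"
    using d_int by (simp add: nn_integral_eq_integral)
  also have "\<dots> < \<infinity>"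
    using d_summable by (subst suminf_ennreal2) (auto simp: integral_nonneg_AE)
  finally have "AE x in M. (\<Sum>k. ennreal \<bar>d k x\<bar>) \<noteq> \<infinity>"
    by (intro nn_integral_noteq_infinite) (auto simp: d_def)
  then have conv: "AE x in M. convergent (\<lambda>k. f (s k) x)"
  proof eventually_elim
    fix x assume "(\<Sum>k. ennreal \<bar>d k x\<bar>) \<noteq> \<infinity>"
    then have "summable (\<lambda>k. \<bar>d k x\<bar>)"
      by (intro summable_suminf_not_top) auto
    then have "summable (\<lambda>k. d k x)"
      by (rule summable_rabs_cancel)
    then have "convergent (\<lambda>n. \<Sum>k<n. d k x)"
      by (simp add: summable_iff_convergent)
    moreover have "(\<Sum>k<n. d k x) = f (s n) x - f (s 0) x" for n
      unfolding d_def by (rule sum_lessThan_telescope)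
    ultimately have "convergent (\<lambda>n. (f (s n) x - f (s 0) x) + f (s 0) x)"
      by (intro convergent_add convergent_const) simp
    then show "convergent (\<lambda>k. f (s k) x)" by simp
  qed
  define g where "g x = lim (\<lambda>k. f (s k) x)" for x
  have [measurable]: "g \<in> borel_measurable M"
    unfolding g_def by measurable
  have lim: "AE x in M. (\<lambda>k. f (s k) x) \<longlonglongrightarrow> g x"
    using conv by eventually_elim (simp add: g_def convergent_LIMSEQ_iff)
  \<comment> \<open>Fatou in \<open>j\<close> with \<open>n\<close> fixed: the Cauchy bound for
    \<open>f n\<close> and \<open>f (s j)\<close> survives the passage from \<open>f (s j)\<close>
    to \<open>g\<close>.\<close>
  have nn_le: "(\<integral>\<^sup>+x. ennreal ((f n x - g x)\<^sup>2) \<partial>M) \<le> ennreal ((1/4) ^ k)" if "n \<ge> n0 k" for n k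
  proof -
    have "(\<integral>\<^sup>+x. ennreal ((f n x - g x)\<^sup>2) \<partial>M) =
        (\<integral>\<^sup>+x. liminf (\<lambda>j. ennreal ((f n x - f (s j) x)\<^sup>2)) \<partial>M)"
    proof (rule nn_integral_cong_AE, use lim in eventually_elim)
      fix x assume "(\<lambda>k. f (s k) x) \<longlonglongrightarrow> g x"
      then have "(\<lambda>j. ennreal ((f n x - f (s j) x)\<^sup>2)) \<longlonglongrightarrow> ennreal ((f n x - g x)\<^sup>2)"
        by (intro tendsto_intros tendsto_ennrealI)
      then show "ennreal ((f n x - g x)\<^sup>2) = liminf (\<lambda>j. ennreal ((f n x - f (s j) x)\<^sup>2))"
        by (rule lim_imp_Liminf[OF sequentially_bot, symmetric])
    qed
    also have "\<dots> \<le> liminf (\<lambda>j. \<integral>\<^sup>+x. ennreal ((f n x - f (s j) x)\<^sup>2) \<partial>M)"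
      by (intro nn_integral_liminf) measurable
    also have "\<dots> = liminf (\<lambda>j. ennreal (LINT x|M. (f n x - f (s j) x)\<^sup>2))"
      using diff_int by (simp add: nn_integral_eq_integral)
    also have "\<dots> \<le> ennreal ((1/4) ^ k)"
    proof (rule Liminf_le)
      show "\<forall>\<^sub>F j in sequentially. ennreal (LINT x|M. (f n x - f (s j) x)\<^sup>2) \<le> ennreal ((1/4) ^ k)"
        using eventually_ge_at_top[of "n0 k"]
      proof eventually_elim
        fix j assume "n0 k \<le> j"
        then have "s j \<ge> n0 k" using s_ge(3)[of j] by linarith
        then show "ennreal (LINT x|M. (f n x - f (s j) x)\<^sup>2) \<le> ennreal ((1/4) ^ k)"
          using n0[of k n "s j"] that by (intro ennreal_leI) auto
      qed
    qed simp
    finally show ?thesis .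
  qed
  have g_int: "integrable M (\<lambda>x. (f n x - g x)\<^sup>2)" if "n \<ge> n0 k" for n k
    using nn_le[OF that] by (intro integrableI_bounded) (auto simp: less_top[symmetric] top_unique)
  \<comment> \<open>At this point only differences \<open>f n - g\<close> are known to be square
    integrable, so \<open>g\<close> is recovered from one of them.\<close>
  have "square_integrable M (\<lambda>x. f (n0 0) x - (f (n0 0) x - g x))"
    using g_int[of 0 "n0 0"] by - (rule square_integrable_diff[OF f], simp add: square_integrable_def)
  then have g: "square_integrable M g" by simp
  moreover have "(\<lambda>n. LINT x|M. (f n x - g x)\<^sup>2) \<longlonglongrightarrow> 0"
  proof (rule LIMSEQ_I)
    fix e :: real assume "e > 0"
    obtain k where k: "(1/4) ^ k < e"
      using real_arch_pow_inv[OF \<open>e > 0\<close>, of "1/4"] by auto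
    have "norm ((LINT x|M. (f n x - g x)\<^sup>2) - 0) < e" if "n \<ge> n0 k" for n
    proof -
      have "ennreal (LINT x|M. (f n x - g x)\<^sup>2) \<le> ennreal ((1/4) ^ k)"
        using nn_le[OF that] g_int[OF that] by (simp add: nn_integral_eq_integral)
      then have "(LINT x|M. (f n x - g x)\<^sup>2) \<le> (1/4) ^ k"
        by (subst (asm) ennreal_le_iff) auto
      then show ?thesis
        using k by (simp add: integral_nonneg_AE)
    qed
    then show "\<exists>n1. \<forall>n\<ge>n1. norm ((LINT x|M. (f n x - g x)\<^sup>2) - 0) < e" by blast
  qed
  ultimately show ?thesis by blast
qed

section \<open>The Hilbert space of a time scale\<close>

locale time_scale =
  fixes T :: "real set"
  assumes closed_T: "closed T" and zero_in_T: "0 \<in> T" and one_in_T: "1 \<in> T" and T_subset: "T \<subseteq> {0..1}"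
begin

section \<open>The map \<open>rho_bar\<close> and the measure \<open>lambda_Delta\<close>\<close>

lemma T_bounds: "t \<in> T \<Longrightarrow> 0 \<le> t" "t \<in> T \<Longrightarrow> t \<le> 1"
  using T_subset by auto

lemma compact_T: "compact T"
  using closed_T T_subset compact_Icc by (metis closed_Int_compact inf.absorb1)

lemma rho_bar_mem:
  assumes "s \<in> {0..1}"
  shows "rho_bar T s \<in> T"
proof (cases "s = 0")
  case False
  then have "Sup {u \<in> T. u < s} \<in> T"
    using assms zero_in_T
    by (intro closed_subset_contains_Sup closed_T) (auto intro: bdd_aboveI[of _ s])
  then show ?thesis using False by (simp add: rho_bar_def)
qed (simp add: rho_bar_def zero_in_T)

text \<open>The point \<open>s = t\<close> is a genuine exception: \<open>rho_bar T t < t\<close>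
  holds for positive \<open>t\<close> isolated from the left in \<open>T\<close>. Being a single
  point, it does not affect Lebesgue measure.\<close>

lemma rho_bar_less_iff:
  assumes "s \<in> {0..1}" and "t \<in> T" and "s \<noteq> t"
  shows "rho_bar T s < t \<longleftrightarrow> s < t"
proof (cases "s = 0")
  case False
  then have s: "s > 0" using assms by simp
  have bdd: "bdd_above {u \<in> T. u < s}"
    by (rule bdd_aboveI[of _ s]) auto
  show ?thesis
  proof
    assume "s < t"
    have "Sup {u \<in> T. u < s} \<le> s"
      using s zero_in_T by (intro cSup_least) auto
    then show "rho_bar T s < t" using \<open>s < t\<close> s by (simp add: rho_bar_def)
  next
    assume less: "rho_bar T s < t"
    show "s < t"
    proof (rule ccontr)
      assume "\<not> s < t"
      then have "t \<le> Sup {u \<in> T. u < s}"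
        using assms bdd by (intro cSup_upper) auto
      then show False using less s by (simp add: rho_bar_def)
    qed
  qed
qed (simp add: rho_bar_def)

lemma mono_on_rho_bar: "mono_on {0..1} (rho_bar T)"
proof (rule mono_onI)
  fix r s :: real assume rs: "r \<in> {0..1}" "s \<in> {0..1}" "r \<le> s"
  show "rho_bar T r \<le> rho_bar T s"
  proof (cases "r = 0")
    case True
    then show ?thesis
      using T_bounds(1)[OF rho_bar_mem[OF rs(2)]] by (simp add: rho_bar_def)
  next
    case False
    then have "Sup {u \<in> T. u < r} \<le> Sup {u \<in> T. u < s}"
      using rs zero_in_T by (intro cSup_subset_mono) (auto intro: bdd_aboveI[of _ s])
    then show ?thesis using False rs by (simp add: rho_bar_def)
  qed
qed

lemma rho_bar_measurable:
  "rho_bar T \<in> measurable (restrict_space lborel {0..1}) (restrict_space borel T)"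
proof -
  have "rho_bar T \<in> borel_measurable (restrict_space borel {0..1})"
    by (rule borel_measurable_mono_on_fnc[OF mono_on_rho_bar])
  then have "rho_bar T \<in> borel_measurable (restrict_space lborel {0..1})"
    by (simp cong: measurable_cong_sets add: sets_restrict_space)
  then show ?thesis
    using rho_bar_mem by (simp add: measurable_restrict_space2_iff space_restrict_space)
qed

lemma space_lambda_Delta [simp]: "space (lambda_Delta T) = T"
  by (simp add: lambda_Delta_def space_restrict_space)

lemma sets_lambda_Delta: "sets (lambda_Delta T) = sets (restrict_space borel T)"
  by (simp add: lambda_Delta_def)

lemma sets_lambda_Delta_Int: "A \<in> sets borel \<Longrightarrow> A \<inter> T \<in> sets (lambda_Delta T)"
  by (auto simp: sets_lambda_Delta sets_restrict_space)

sublocale lambda_Delta: prob_space "lambda_Delta T"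
proof -
  have "prob_space (restrict_space lborel {0..1::real})"
    by (rule prob_spaceI) (simp add: emeasure_restrict_space space_restrict_space)
  then show "prob_space (lambda_Delta T)"
    unfolding lambda_Delta_def by (rule prob_space.prob_space_distr[OF _ rho_bar_measurable])
qed

text \<open>By \<open>rho_bar_less_iff\<close> the preimage of the initial segment lies between
  \<open>{0..<t}\<close> and \<open>{0..t}\<close>, which both have length \<open>t\<close>.\<close>

lemma measure_lambda_Delta_initial:
  assumes "t \<in> T"
  shows "measure (lambda_Delta T) ({0..<t} \<inter> T) = t"
proof -
  define P where "P = rho_bar T -` ({0..<t} \<inter> T) \<inter> {0..1}"
  have A: "{0..<t} \<inter> T \<in> sets (restrict_space borel T)"
    by (auto simp: sets_restrict_space)
  have "P \<in> sets (restrict_space lborel {0..1})"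
    using measurable_sets[OF rho_bar_measurable A] by (simp add: P_def space_restrict_space)
  then have P: "P \<in> sets lborel" by (auto simp: sets_restrict_space)
  have "s \<in> P" if "0 \<le> s" "s < t" for s
    using that rho_bar_less_iff[of s t] rho_bar_mem[of s] T_bounds[of "rho_bar T s"] T_bounds[OF assms] assms
    by (simp add: P_def)
  then have "{0..<t} \<subseteq> P" by auto
  moreover have "s \<le> t" if "s \<in> P" for s
    using that rho_bar_less_iff[of s t] assms by (cases "s = t") (simp_all add: P_def)
  then have "P \<subseteq> {0..t}" by (auto simp: P_def)
  ultimately have "emeasure lborel {0..<t} \<le> emeasure lborel P" "emeasure lborel P \<le> emeasure lborel {0..t}"
    using P by (auto intro!: emeasure_mono)
  then have "emeasure lborel P = ennreal t"
    using T_bounds[OF assms] by simp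
  then have "emeasure (lambda_Delta T) ({0..<t} \<inter> T) = ennreal t"
    unfolding lambda_Delta_def
    by (subst emeasure_distr[OF rho_bar_measurable A])
      (simp add: emeasure_restrict_space space_restrict_space P_def)
  then show ?thesis
    using T_bounds[OF assms] by (simp add: measure_def)
qed

text \<open>No initial segment contains the point \<open>1\<close>; it has to be null for the
  initial segments to determine a function almost everywhere.\<close>

lemma AE_lambda_Delta_less_1: "AE s in lambda_Delta T. s \<in> {0..<1} \<inter> T"
  using lambda_Delta.AE_in_set_eq_1[of "{0..<1} \<inter> T"] measure_lambda_Delta_initial[OF one_in_T]
    sets_lambda_Delta_Int[of "{0..<1}"] by simp

text \<open>Dynkin's argument: half lines are stable under intersection and generate the Borel sets,
  and vanishing of the integral over \<open>A \<inter> T\<close> passes to complements and disjoint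
  unions. The complement step needs the integral over all of \<open>T\<close>, which reduces to
  \<open>t = 1\<close> because \<open>1\<close> is null.\<close>

lemma AE_lambda_Delta_eq_0:
  fixes f :: "real \<Rightarrow> real"
  assumes int: "integrable (lambda_Delta T) f"
    and zero: "\<And>t. t \<in> T \<Longrightarrow> (LINT s:{0..<t} \<inter> T|lambda_Delta T. f s) = 0"
  shows "AE s in lambda_Delta T. f s = 0"
proof -
  have set_int: "set_integrable (lambda_Delta T) A f" if "A \<in> sets (lambda_Delta T)" for A
    unfolding set_integrable_def by (rule integrable_mult_indicator[OF that int])
  have total: "(LINT s:T|lambda_Delta T. f s) = 0"
  proof -
    have "(LINT s:T|lambda_Delta T. f s) = (LINT s:{0..<1} \<inter> T|lambda_Delta T. f s)"
      unfolding set_lebesgue_integral_def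
    proof (rule integral_cong_AE)
      show "AE s in lambda_Delta T. indicator T s *\<^sub>R f s = indicator ({0..<1} \<inter> T) s *\<^sub>R f s"
        using AE_lambda_Delta_less_1 by eventually_elim simp
    qed (use set_int[of T] set_int[of "{0..<1} \<inter> T"] sets_lambda_Delta_Int[of UNIV]
        sets_lambda_Delta_Int[of "{0..<1}"] in \<open>auto simp: set_integrable_def\<close>)
    then show ?thesis using zero[OF one_in_T] by simp
  qed
  have initial: "(LINT s:{..<a} \<inter> T|lambda_Delta T. f s) = 0" for a
  proof (cases "a \<le> 1")
    case True
    \<comment> \<open>Rounding \<open>a\<close> up to the next point of \<open>T\<close> does not
      change which points of \<open>T\<close> lie below it.\<close>
    define t where "t = Inf {u \<in> T. a \<le> u}"
    have bdd: "bdd_below {u \<in> T. a \<le> u}"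
      by (rule bdd_belowI[of _ a]) auto
    have t: "t \<in> T"
      unfolding t_def using True one_in_T bdd
      by (intro closed_subset_contains_Inf[OF closed_T]) auto
    have "a \<le> t"
      unfolding t_def using True one_in_T by (intro cInf_greatest) auto
    moreover have "t \<le> u" if "u \<in> T" "a \<le> u" for u
      unfolding t_def using bdd that by (intro cInf_lower) auto
    ultimately have "{..<a} \<inter> T = {0..<t} \<inter> T"
      using T_bounds by fastforce
    then show ?thesis using zero[OF t] by simp
  next
    case False
    then have "{..<a} \<inter> T = T" using T_bounds by fastforce
    then show ?thesis using total by simp
  qed
  have borel: "(LINT s:A \<inter> T|lambda_Delta T. f s) = 0" if "A \<in> sets borel" for A
  proof -
    have borel_eq: "sigma_sets UNIV (range (lessThan :: real \<Rightarrow> real set)) = sets borel"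
      by (simp add: borel_Iio)
    have "{..<a} \<inter> {..<b} = {..<min a b}" for a b :: real by auto
    then have "Int_stable (range (lessThan :: real \<Rightarrow> real set))"
      by (auto simp: Int_stable_def)
    moreover have "range (lessThan :: real \<Rightarrow> real set) \<subseteq> Pow UNIV" by simp
    moreover have "A \<in> sigma_sets UNIV (range lessThan)"
      using that by (simp add: borel_eq)
    ultimately show ?thesis
    proof (induction A rule: sigma_sets_induct_disjoint)
      case (basic A)
      then show ?case using initial by auto
    next
      case empty
      show ?case by (simp add: set_lebesgue_integral_def)
    next
      case (compl A)
      have A: "A \<inter> T \<in> sets (lambda_Delta T)" "(UNIV - A) \<inter> T \<in> sets (lambda_Delta T)"
        using compl(1) by (auto intro!: sets_lambda_Delta_Int simp: borel_eq)
      have "(LINT s:(A \<inter> T) \<union> ((UNIV - A) \<inter> T)|lambda_Delta T. f s) =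
          (LINT s:A \<inter> T|lambda_Delta T. f s) + (LINT s:(UNIV - A) \<inter> T|lambda_Delta T. f s)"
        using A by (intro set_integral_Un set_int) auto
      moreover have "(A \<inter> T) \<union> ((UNIV - A) \<inter> T) = T" by auto
      ultimately show ?case using compl(2) total by simp
    next
      case (union A)
      have A: "A i \<inter> T \<in> sets (lambda_Delta T)" for i
        using union(2) by (intro sets_lambda_Delta_Int) (auto simp: borel_eq)
      have "(LINT s:(\<Union>i. A i \<inter> T)|lambda_Delta T. f s) = (\<Sum>i. LINT s:A i \<inter> T|lambda_Delta T. f s)"
        using A union(1)
        by (intro lebesgue_integral_countable_add set_int sets.countable_UN)
          (auto simp: disjoint_family_on_def)
      moreover have "(\<Union>i. A i \<inter> T) = (\<Union>i. A i) \<inter> T" by auto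
      ultimately show ?case using union(3) by simp
    qed
  qed
  show ?thesis
  proof (rule density_unique_real[OF int])
    show "(LINT s:A|lambda_Delta T. f s) = (LINT s:A|lambda_Delta T. 0)" if "A \<in> sets (lambda_Delta T)" for A
      using that borel
      by (auto simp: sets_lambda_Delta sets_restrict_space Int_commute)
  qed simp
qed

section \<open>Delta derivatives and their primitives\<close>

lemma is_delta_derivative_iff:
  "is_delta_derivative T h f \<longleftrightarrow> square_integrable (lambda_Delta T) f \<and>
    (\<forall>t\<in>T. h t = (LINT s:{0..<t} \<inter> T|lambda_Delta T. f s))"
  by (auto simp: is_delta_derivative_def square_integrable_def)

lemma square_integrable_set_integrable:
  assumes "square_integrable (lambda_Delta T) f"
  shows "set_integrable (lambda_Delta T) ({0..<t} \<inter> T) f"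
  unfolding set_integrable_def
  using lambda_Delta.square_integrable_imp_integrable[OF assms]
  by (intro integrable_mult_indicator sets_lambda_Delta_Int) auto

lemma is_delta_derivative_unique:
  assumes "is_delta_derivative T h f" and "is_delta_derivative T h g"
  shows "AE s in lambda_Delta T. f s = g s"
proof -
  have fg: "square_integrable (lambda_Delta T) f" "square_integrable (lambda_Delta T) g"
    using assms by (auto simp: is_delta_derivative_iff)
  have "AE s in lambda_Delta T. f s - g s = 0"
  proof (rule AE_lambda_Delta_eq_0)
    show "integrable (lambda_Delta T) (\<lambda>s. f s - g s)"
      using fg by (intro lambda_Delta.square_integrable_imp_integrable square_integrable_diff)
    show "(LINT s:{0..<t} \<inter> T|lambda_Delta T. f s - g s) = 0" if "t \<in> T" for t
      using assms that fg square_integrable_set_integrable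
      by (subst set_integral_diff(2)) (auto simp: is_delta_derivative_iff)
  qed
  then show ?thesis by simp
qed

lemma is_delta_derivative_add:
  assumes "is_delta_derivative T h f" and "is_delta_derivative T k g"
  shows "is_delta_derivative T (h + k) (\<lambda>s. f s + g s)"
  using assms square_integrable_set_integrable
  by (auto simp: is_delta_derivative_iff square_integrable_add set_integral_add(2))

lemma is_delta_derivative_scaleR:
  assumes "is_delta_derivative T h f"
  shows "is_delta_derivative T (c *\<^sub>R h) (\<lambda>s. c * f s)"
  using assms by (auto simp: is_delta_derivative_iff square_integrable_scale scaleR_fun_def)

lemma is_delta_derivative_diff:
  assumes "is_delta_derivative T h f" and "is_delta_derivative T k g"
  shows "is_delta_derivative T (h - k) (\<lambda>s. f s - g s)"
  using is_delta_derivative_add[OF assms(1) is_delta_derivative_scaleR[OF assms(2), of "-1"]]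
  by simp

lemma integral_initial:
  assumes "t \<in> T"
  shows "(LINT s|lambda_Delta T. indicator ({0..<t} \<inter> T) s) = t"
  using assms measure_lambda_Delta_initial sets_lambda_Delta_Int[of "{0..<t}"] by simp

text \<open>For \<open>s \<le> t\<close> the increment is the integral of \<open>f\<close> against
  the indicator of \<open>{s..<t} \<inter> T\<close>, whose mean square is \<open>t - s\<close>;
  Cauchy-Schwarz finishes.\<close>

lemma delta_primitive_Hoelder:
  assumes "is_delta_derivative T h f" and "s \<in> T" and "t \<in> T"
  shows "\<bar>h t - h s\<bar> \<le> sqrt \<bar>t - s\<bar> * sqrt (LINT s|lambda_Delta T. (f s)\<^sup>2)"
proof -
  have *: "\<bar>h t - h s\<bar> \<le> sqrt \<bar>t - s\<bar> * sqrt (LINT s|lambda_Delta T. (f s)\<^sup>2)"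
    if st: "s \<in> T" "t \<in> T" "s \<le> t" for s t
  proof -
    define g :: "real \<Rightarrow> real" where "g x = indicator ({0..<t} \<inter> T) x - indicator ({0..<s} \<inter> T) x" for x
    have f: "square_integrable (lambda_Delta T) f"
      using assms by (simp add: is_delta_derivative_iff)
    have ind: "square_integrable (lambda_Delta T) (indicator ({0..<u} \<inter> T))" for u
      by (intro square_integrable_indicator sets_lambda_Delta_Int) (simp_all add: less_top[symmetric])
    have int: "integrable (lambda_Delta T) (indicator ({0..<u} \<inter> T) :: real \<Rightarrow> real)" for u
      using ind by (rule lambda_Delta.square_integrable_imp_integrable)
    have g: "square_integrable (lambda_Delta T) g"
      unfolding g_def by (intro square_integrable_diff ind)
    have "(g x)\<^sup>2 = g x" for x
      using st by (auto simp: g_def indicator_def)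
    then have "(LINT x|lambda_Delta T. (g x)\<^sup>2) = t - s"
      using int integral_initial st by (simp add: g_def)
    moreover have "h t - h s = (LINT x|lambda_Delta T. g x * f x)"
    proof -
      have "integrable (lambda_Delta T) (\<lambda>x. indicator ({0..<u} \<inter> T) x * f x)" for u
        by (rule square_integrable_mult[OF ind f])
      then show ?thesis
        using st assms(1) by (simp add: is_delta_derivative_iff set_lebesgue_integral_def g_def left_diff_distrib)
    qed
    ultimately show ?thesis
      using integral_Cauchy_Schwarz[OF g f] st by simp
  qed
  show ?thesis
    using *[of s t] *[of t s] assms by (cases "s \<le> t") (simp_all add: abs_minus_commute)
qed

text \<open>The Hoelder bound makes a primitive continuous on \<open>T\<close>, so membership
  reduces to having a derivative and vanishing off \<open>T\<close>.\<close>

lemma in_H_spaceI: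
  assumes "is_delta_derivative T h f" and "\<And>t. t \<notin> T \<Longrightarrow> h t = 0"
  shows "h \<in> H_space T"
proof -
  have "continuous_on T h"
    unfolding continuous_on_def
  proof
    fix x assume "x \<in> T"
    define c where "c = sqrt (LINT s|lambda_Delta T. (f s)\<^sup>2)"
    have "((\<lambda>y. sqrt \<bar>y - x\<bar> * c) \<longlongrightarrow> sqrt \<bar>x - x\<bar> * c) (at x within T)"
      by (intro tendsto_intros)
    then have "((\<lambda>y. h y - h x) \<longlongrightarrow> 0) (at x within T)"
      using delta_primitive_Hoelder[OF assms(1) \<open>x \<in> T\<close>]
      by (intro Lim_null_comparison[of "\<lambda>y. h y - h x" "\<lambda>y. sqrt \<bar>y - x\<bar> * c"])
        (auto simp: eventually_at_filter c_def)
    then show "(h \<longlongrightarrow> h x) (at x within T)"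
      by (simp add: LIM_zero_iff)
  qed
  moreover have "h 0 = 0"
    using assms(1) zero_in_T by (simp add: is_delta_derivative_iff set_lebesgue_integral_def)
  ultimately show ?thesis
    using assms by (auto simp: H_space_def C_space_def)
qed

lemma delta_derivative: "h \<in> H_space T \<Longrightarrow> is_delta_derivative T h (delta_derivative T h)"
  unfolding delta_derivative_def
  by (rule someI_ex[of "is_delta_derivative T h"]) (simp add: H_space_def)

text \<open>The derivative picked by \<open>SOME\<close> need not depend linearly on the function.
  This lemma replaces it by any convenient derivative, such as a sum of derivatives or the indicator
  belonging to a kernel.\<close>

lemma H_inner_eq:
  assumes "is_delta_derivative T h f" and "is_delta_derivative T k g"
  shows "H_inner T h k = (LINT s|lambda_Delta T. f s * g s)"
proof -
  have h: "is_delta_derivative T h (delta_derivative T h)"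
    and k: "is_delta_derivative T k (delta_derivative T k)"
    unfolding delta_derivative_def using assms
    by (auto intro: someI[of "is_delta_derivative T h"] someI[of "is_delta_derivative T k"])
  have [measurable]: "f \<in> borel_measurable (lambda_Delta T)" "g \<in> borel_measurable (lambda_Delta T)"
    "delta_derivative T h \<in> borel_measurable (lambda_Delta T)"
    "delta_derivative T k \<in> borel_measurable (lambda_Delta T)"
    using assms h k by (simp_all add: is_delta_derivative_def)
  show ?thesis
    unfolding H_inner_def
  proof (rule integral_cong_AE)
    show "AE s in lambda_Delta T. delta_derivative T h s * delta_derivative T k s = f s * g s"
      using is_delta_derivative_unique[OF h assms(1)] is_delta_derivative_unique[OF k assms(2)]
      by eventually_elim simp
  qed measurable
qed

section \<open>Hilbert space structure, completeness and separability\<close>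

lemma subspace_C_space: "subspace (C_space T)"
  by (auto simp: subspace_def C_space_def scaleR_fun_def plus_fun_def zero_fun_def
      intro!: continuous_intros)

lemma subspace_H_space: "subspace (H_space T)"
  unfolding subspace_def
proof (intro conjI ballI allI)
  have "is_delta_derivative T 0 (\<lambda>_. 0)"
    by (simp add: is_delta_derivative_iff square_integrable_def)
  then show "0 \<in> H_space T"
    by (rule in_H_spaceI) simp
next
  fix x y assume "x \<in> H_space T" "y \<in> H_space T"
  then show "x + y \<in> H_space T"
    using is_delta_derivative_add subspace_add[OF subspace_C_space]
    by (fastforce simp: H_space_def)
next
  fix c :: real and x assume "x \<in> H_space T"
  then show "c *\<^sub>R x \<in> H_space T"
    using is_delta_derivative_scaleR subspace_scale[OF subspace_C_space]
    by (fastforce simp: H_space_def)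
qed

lemma H_space_zero_off: "h \<in> H_space T \<Longrightarrow> t \<notin> T \<Longrightarrow> h t = 0"
  and H_space_continuous: "h \<in> H_space T \<Longrightarrow> continuous_on T h"
  and H_space_subset_C_space: "H_space T \<subseteq> C_space T"
  by (auto simp: H_space_def C_space_def)

sublocale H: inner_product_on "H_space T" "H_inner T"
proof
  fix x y z and c :: real
  assume x: "x \<in> H_space T"
  note dx = delta_derivative[OF x]
  then have sx: "square_integrable (lambda_Delta T) (delta_derivative T x)"
    by (simp add: is_delta_derivative_iff)
  show "0 \<le> H_inner T x x"
    by (simp add: H_inner_def integral_nonneg_AE)
  show "H_inner T x x = 0 \<longleftrightarrow> x = 0"
  proof
    assume "x = 0"
    then have "is_delta_derivative T x (\<lambda>_. 0)"
      by (simp add: is_delta_derivative_iff square_integrable_def)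
    then show "H_inner T x x = 0"
      by (subst H_inner_eq) auto
  next
    assume "H_inner T x x = 0"
    then have "(LINT s|lambda_Delta T. (delta_derivative T x s)\<^sup>2) = 0"
      by (simp add: H_inner_def power2_eq_square)
    then have AE: "AE s in lambda_Delta T. delta_derivative T x s = 0"
      using sx by (subst (asm) integral_nonneg_eq_0_iff_AE) (auto simp: square_integrable_def)
    have "x t = 0" if "t \<in> T" for t
    proof -
      have "x t = (LINT s:{0..<t} \<inter> T|lambda_Delta T. delta_derivative T x s)"
        using dx that by (simp add: is_delta_derivative_iff)
      also have "\<dots> = 0"
        unfolding set_lebesgue_integral_def using AE
        by (intro integral_eq_zero_AE) (auto elim!: eventually_mono)
      finally show ?thesis .
    qed
    then show "x = 0"
      using H_space_zero_off[OF x] by (auto simp: fun_eq_iff)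
  qed
  assume y: "y \<in> H_space T"
  note dy = delta_derivative[OF y]
  then have sy: "square_integrable (lambda_Delta T) (delta_derivative T y)"
    by (simp add: is_delta_derivative_iff)
  show "H_inner T x y = H_inner T y x"
    by (simp add: H_inner_def mult.commute)
  show "H_inner T (c *\<^sub>R x) y = c * H_inner T x y"
    unfolding H_inner_eq[OF is_delta_derivative_scaleR[OF dx] dy] H_inner_eq[OF dx dy]
    by (simp add: mult.assoc)
  assume z: "z \<in> H_space T"
  note dz = delta_derivative[OF z]
  then have sz: "square_integrable (lambda_Delta T) (delta_derivative T z)"
    by (simp add: is_delta_derivative_iff)
  show "H_inner T (x + y) z = H_inner T x z + H_inner T y z"
    unfolding H_inner_eq[OF is_delta_derivative_add[OF dx dy] dz] H_inner_eq[OF dx dz] H_inner_eq[OF dy dz]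
    by (simp add: distrib_right square_integrable_mult[OF sx sz] square_integrable_mult[OF sy sz])
qed (rule subspace_H_space)

lemma inner_norm_diff:
  assumes "is_delta_derivative T h f" and "is_delta_derivative T k g"
  shows "inner_norm (H_inner T) (h - k) = sqrt (LINT s|lambda_Delta T. (f s - g s)\<^sup>2)"
  unfolding inner_norm_def
  by (subst H_inner_eq[OF is_delta_derivative_diff[OF assms] is_delta_derivative_diff[OF assms]])
    (simp add: power2_eq_square)

text \<open>Differentiation is isometric for the mean square norm, and every square integrable
  function is the derivative of its primitive; thus the limit from
  \<open>square_integrable_complete\<close> only has to be integrated.\<close>

lemma H_space_mcomplete: "H.mcomplete"
proof (rule H.mcompleteI)
  fix x :: "nat \<Rightarrow> real \<Rightarrow> real"
  assume x: "\<And>n. x n \<in> H_space T"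
    and Cauchy: "\<And>e. e > 0 \<Longrightarrow> \<exists>n0. \<forall>m\<ge>n0. \<forall>n\<ge>n0. inner_norm (H_inner T) (x m - x n) < e"
  define f where "f n = delta_derivative T (x n)" for n
  have f: "is_delta_derivative T (x n) (f n)" for n
    unfolding f_def by (rule delta_derivative[OF x])
  have sf: "square_integrable (lambda_Delta T) (f n)" for n
    using f by (simp add: is_delta_derivative_iff)
  have "\<exists>n0. \<forall>m\<ge>n0. \<forall>n\<ge>n0. (LINT s|lambda_Delta T. (f m s - f n s)\<^sup>2) < e" if "e > 0" for e
    using Cauchy[of "sqrt e"] that by (simp add: inner_norm_diff[OF f f])
  then obtain g where g: "square_integrable (lambda_Delta T) g"
    and lim: "(\<lambda>n. LINT s|lambda_Delta T. (f n s - g s)\<^sup>2) \<longlonglongrightarrow> 0"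
    using lambda_Delta.square_integrable_complete[of f] sf by blast
  define y where "y t = (if t \<in> T then LINT s:{0..<t} \<inter> T|lambda_Delta T. g s else 0)" for t
  have y: "is_delta_derivative T y g"
    using g by (simp add: is_delta_derivative_iff y_def)
  then have "y \<in> H_space T"
    by (rule in_H_spaceI) (simp add: y_def)
  moreover have "(\<lambda>n. inner_norm (H_inner T) (x n - y)) \<longlonglongrightarrow> 0"
    using tendsto_real_sqrt[OF lim] by (simp add: inner_norm_diff[OF f y])
  ultimately show "\<exists>y\<in>H_space T. (\<lambda>n. inner_norm (H_inner T) (x n - y)) \<longlonglongrightarrow> 0" by blast
qed

text \<open>The covariance function of Brownian motion, cut off outside \<open>T\<close> to agree
  with the representation by zero extension.\<close>

definition min_kernel :: "real \<Rightarrow> real \<Rightarrow> real"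
  where "min_kernel t s = (if s \<in> T then min s t else 0)"

lemma is_delta_derivative_kernel:
  assumes "t \<in> T"
  shows "is_delta_derivative T (min_kernel t) (indicator ({0..<t} \<inter> T))"
proof -
  have "(LINT s:{0..<r} \<inter> T|lambda_Delta T. indicator ({0..<t} \<inter> T) s) = min r t" if "r \<in> T" for r
  proof -
    have "(LINT s:{0..<r} \<inter> T|lambda_Delta T. indicator ({0..<t} \<inter> T) s) =
        (LINT s|lambda_Delta T. indicator ({0..<min r t} \<inter> T) s)"
      unfolding set_lebesgue_integral_def
      by (intro Bochner_Integration.integral_cong) (auto simp: indicator_def)
    also have "\<dots> = min r t"
      using that assms by (intro integral_initial) (simp add: min_def)
    finally show ?thesis .
  qed
  then show ?thesis
    by (auto simp: is_delta_derivative_iff min_kernel_def less_top[symmetric]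
        intro!: square_integrable_indicator sets_lambda_Delta_Int)
qed

lemma kernel_in_H_space: "t \<in> T \<Longrightarrow> min_kernel t \<in> H_space T"
  using is_delta_derivative_kernel by (rule in_H_spaceI) (auto simp: min_kernel_def)

lemma H_inner_kernel:
  assumes "h \<in> H_space T" and "t \<in> T"
  shows "H_inner T h (min_kernel t) = h t"
  using delta_derivative[OF assms(1)] assms(2)
  by (subst H_inner_eq[OF delta_derivative[OF assms(1)] is_delta_derivative_kernel[OF assms(2)]])
    (simp add: is_delta_derivative_iff set_lebesgue_integral_def mult.commute)

lemma H_space_separable: "separable_space (norm_topology (H_space T) (inner_norm (H_inner T)))"
  unfolding H.separable_space_iff
proof -
  obtain T0 where T0: "countable T0" "T0 \<subseteq> T" "T \<subseteq> closure T0"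
    using separable by blast
  have closure: "closure T0 = T"
    using T0 closed_T closure_minimal by blast
  \<comment> \<open>Indexing combinations by lists makes countability immediate and turns addition
    into concatenation.\<close>
  define combination where "combination xs = (\<Sum>(q, t)\<leftarrow>xs. q *\<^sub>R min_kernel t)" for xs
  define W where "W = combination ` lists (\<rat> \<times> T0)"
  have "countable W"
    unfolding W_def using T0 countable_rat by (intro countable_image countable_lists countable_SIGMA)
  moreover have "combination xs \<in> H_space T" if "xs \<in> lists (\<rat> \<times> T0)" for xs
    using that T0
    by (induction xs) (auto simp: combination_def intro!: H.zero_mem H.add_mem H.scaleR_mem kernel_in_H_space)
  then have "W \<subseteq> H_space T" by (auto simp: W_def)
  moreover have "\<exists>w\<in>W. inner_norm (H_inner T) (h - w) < e" if "h \<in> H_space T" "e > 0" for h e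
  proof (rule H.total_imp_dense[OF H_space_mcomplete \<open>W \<subseteq> H_space T\<close>])
    show "0 \<in> W"
      unfolding W_def by (rule image_eqI[of _ _ "[]"]) (auto simp: combination_def)
  next
    fix x y assume "x \<in> W" "y \<in> W"
    then obtain xs ys where "xs \<in> lists (\<rat> \<times> T0)" "ys \<in> lists (\<rat> \<times> T0)" "x = combination xs" "y = combination ys"
      by (auto simp: W_def)
    then show "x + y \<in> W"
      unfolding W_def by (intro image_eqI[of _ _ "xs @ ys"]) (auto simp: combination_def)
  next
    fix q :: real and x assume "q \<in> \<rat>" "x \<in> W"
    then obtain xs where xs: "xs \<in> lists (\<rat> \<times> T0)" "x = combination xs"
      by (auto simp: W_def)
    have "q *\<^sub>R combination xs = combination (map (\<lambda>(r, t). (q * r, t)) xs)"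
      by (induction xs) (auto simp: combination_def scaleR_fun_def fun_eq_iff distrib_left)
    then show "q *\<^sub>R x \<in> W"
      unfolding W_def using xs \<open>q \<in> \<rat>\<close>
      by (intro image_eqI[of _ _ "map (\<lambda>(r, t). (q * r, t)) xs"]) (auto intro!: Rats_mult)
  next
    fix x assume x: "x \<in> H_space T" and orth: "\<And>w. w \<in> W \<Longrightarrow> H_inner T x w = 0"
    have "x t = 0" if "t \<in> T0" for t
    proof -
      have "min_kernel t \<in> W"
        unfolding W_def using that by (intro image_eqI[of _ _ "[(1, t)]"]) (auto simp: combination_def)
      then show ?thesis
        using orth H_inner_kernel[OF x] T0 that by fastforce
    qed
    then have "x t = 0" if "t \<in> T" for t
      using continuous_constant_on_closure[of T0 x 0 t] H_space_continuous[OF x] that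
      by (simp add: closure)
    then show "x = 0"
      using H_space_zero_off[OF x] by (auto simp: fun_eq_iff)
  qed fact+
  ultimately show "\<exists>D\<subseteq>H_space T. countable D \<and>
      (\<forall>x\<in>H_space T. \<forall>e>0. \<exists>d\<in>D. inner_norm (H_inner T) (x - d) < e)"
    by blast
qed

lemma H_space_separable_hilbert: "separable_hilbert_on (H_space T) (H_inner T)"
  by unfold_locales
    (simp_all add: subspace_H_space H.inner_commute H.inner_add_left H.inner_scaleR_left
      H.inner_nonneg H.inner_eq_0_iff H_space_mcomplete H_space_separable)

end

section \<open>Continuous functions on a time scale and their interpolation\<close>

context time_scale
begin

lemma C_space_continuous: "\<omega> \<in> C_space T \<Longrightarrow> continuous_on T \<omega>"
  and C_space_zero: "\<omega> \<in> C_space T \<Longrightarrow> \<omega> 0 = 0"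
  and C_space_zero_off: "\<omega> \<in> C_space T \<Longrightarrow> t \<notin> T \<Longrightarrow> \<omega> t = 0"
  by (auto simp: C_space_def)

lemma abs_le_sup_norm:
  assumes "\<omega> \<in> C_space T" and "t \<in> T"
  shows "\<bar>\<omega> t\<bar> \<le> sup_norm T \<omega>"
proof -
  have "compact ((\<lambda>t. \<bar>\<omega> t\<bar>) ` T)"
    using C_space_continuous[OF assms(1)] compact_T by (intro compact_continuous_image continuous_intros)
  then have "bdd_above ((\<lambda>t. \<bar>\<omega> t\<bar>) ` T)"
    by (intro bounded_imp_bdd_above compact_imp_bounded)
  then show ?thesis
    unfolding sup_norm_def using assms(2) by (rule cSUP_upper[rotated])
qed

lemma sup_norm_le: "(\<And>t. t \<in> T \<Longrightarrow> \<bar>\<omega> t\<bar> \<le> c) \<Longrightarrow> sup_norm T \<omega> \<le> c"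
  unfolding sup_norm_def using zero_in_T by (intro cSUP_least) auto

sublocale C: normed_on "C_space T" "sup_norm T"
proof
  fix x assume x: "x \<in> C_space T"
  show nonneg: "0 \<le> sup_norm T x"
    using abs_le_sup_norm[OF x zero_in_T] by simp
  show "sup_norm T x = 0 \<longleftrightarrow> x = 0"
  proof
    assume 0: "sup_norm T x = 0"
    have "x t = 0" for t
      using abs_le_sup_norm[OF x, of t] C_space_zero_off[OF x, of t] 0 by (cases "t \<in> T") auto
    then show "x = 0" by (auto simp: fun_eq_iff)
  next
    assume "x = 0"
    then have "sup_norm T x \<le> 0" by (intro sup_norm_le) simp
    then show "sup_norm T x = 0" using nonneg by simp
  qed
  have le: "sup_norm T (c *\<^sub>R y) \<le> \<bar>c\<bar> * sup_norm T y" if "y \<in> C_space T" for c y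
    using abs_le_sup_norm[OF that]
    by (intro sup_norm_le) (auto simp: scaleR_fun_def abs_mult intro: mult_left_mono)
  show "sup_norm T (c *\<^sub>R x) = \<bar>c\<bar> * sup_norm T x" for c
  proof (cases "c = 0")
    case True
    then have "sup_norm T (c *\<^sub>R x) \<le> 0" "0 \<le> sup_norm T (c *\<^sub>R x)"
      using le[OF x, of c] abs_le_sup_norm[OF subspace_scale[OF subspace_C_space x] zero_in_T, of c]
      by simp_all
    then show ?thesis using True by simp
  next
    case False
    \<comment> \<open>The reverse inequality is \<open>le\<close> applied to
      \<open>c *\<^sub>R x\<close> with the inverse scalar.\<close>
    have "sup_norm T (inverse c *\<^sub>R (c *\<^sub>R x)) \<le> \<bar>inverse c\<bar> * sup_norm T (c *\<^sub>R x)"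
      by (intro le subspace_scale[OF subspace_C_space x])
    then have "\<bar>c\<bar> * sup_norm T x \<le> sup_norm T (c *\<^sub>R x)"
      using False by (simp add: field_simps)
    then show ?thesis using le[OF x, of c] by simp
  qed
  fix y assume y: "y \<in> C_space T"
  have "\<bar>x t + y t\<bar> \<le> sup_norm T x + sup_norm T y" if "t \<in> T" for t
    using abs_le_sup_norm[OF x that] abs_le_sup_norm[OF y that] by linarith
  then show "sup_norm T (x + y) \<le> sup_norm T x + sup_norm T y"
    by (intro sup_norm_le) simp
qed (rule subspace_C_space)

lemma sup_norm_tendsto_0:
  assumes "\<And>n. x n \<in> C_space T"
    and "\<And>e. e > 0 \<Longrightarrow> \<exists>n0. \<forall>n\<ge>n0. \<forall>t\<in>T. \<bar>x n t\<bar> \<le> e"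
  shows "(\<lambda>n. sup_norm T (x n)) \<longlonglongrightarrow> 0"
proof (rule LIMSEQ_I)
  fix e :: real assume "e > 0"
  then obtain n0 where n0: "\<forall>n\<ge>n0. \<forall>t\<in>T. \<bar>x n t\<bar> \<le> e / 2"
    using assms(2)[of "e / 2"] by auto
  have "norm (sup_norm T (x n) - 0) < e" if "n \<ge> n0" for n
    using sup_norm_le[of "x n" "e / 2"] n0 that \<open>e > 0\<close> C.norm_nonneg[OF assms(1)[of n]] by simp
  then show "\<exists>n0. \<forall>n\<ge>n0. norm (sup_norm T (x n) - 0) < e" by blast
qed

lemma C_space_mcomplete: "C.mcomplete"
proof (rule C.mcompleteI)
  fix x :: "nat \<Rightarrow> real \<Rightarrow> real"
  assume x: "\<And>n. x n \<in> C_space T"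
    and Cauchy: "\<And>e. e > 0 \<Longrightarrow> \<exists>n0. \<forall>m\<ge>n0. \<forall>n\<ge>n0. sup_norm T (x m - x n) < e"
  have "\<forall>e>0. \<exists>n0. \<forall>m n t. n0 \<le> m \<and> n0 \<le> n \<and> t \<in> T \<longrightarrow> dist (x m t) (x n t) < e"
  proof (intro allI impI)
    fix e :: real assume "e > 0"
    then obtain n0 where n0: "\<forall>m\<ge>n0. \<forall>n\<ge>n0. sup_norm T (x m - x n) < e"
      using Cauchy by blast
    have "dist (x m t) (x n t) < e" if "n0 \<le> m" "n0 \<le> n" "t \<in> T" for m n t
      using abs_le_sup_norm[OF C.diff_mem[OF x x] \<open>t \<in> T\<close>, of m n] n0 that
      by (fastforce simp: dist_real_def)
    then show "\<exists>n0. \<forall>m n t. n0 \<le> m \<and> n0 \<le> n \<and> t \<in> T \<longrightarrow> dist (x m t) (x n t) < e" by blast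
  qed
  then obtain l where l: "\<And>e. e > 0 \<Longrightarrow> \<exists>n0. \<forall>n t. n0 \<le> n \<and> t \<in> T \<longrightarrow> dist (x n t) (l t) < e"
    using uniformly_convergent_eq_cauchy[of "\<lambda>t. t \<in> T" x] by blast
  define y where "y t = (if t \<in> T then l t else 0)" for t
  have "uniform_limit T x y sequentially"
    using l by (fastforce simp: uniform_limit_iff eventually_sequentially y_def)
  then have "continuous_on T y"
    using C_space_continuous[OF x] by (intro uniform_limit_theorem) auto
  moreover have "y 0 = 0"
  proof -
    have "(\<lambda>n. x n 0) \<longlonglongrightarrow> y 0"
      using \<open>uniform_limit T x y sequentially\<close> zero_in_T by (rule tendsto_uniform_limitI)
    then show ?thesis
      using C_space_zero[OF x] by (simp add: LIMSEQ_const_iff)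
  qed
  ultimately have y: "y \<in> C_space T"
    by (auto simp: C_space_def y_def)
  moreover have "(\<lambda>n. sup_norm T (x n - y)) \<longlonglongrightarrow> 0"
  proof (rule sup_norm_tendsto_0)
    show "x n - y \<in> C_space T" for n using x y by (rule C.diff_mem)
    fix e :: real assume "e > 0"
    then obtain n0 where "\<forall>n t. n0 \<le> n \<and> t \<in> T \<longrightarrow> dist (x n t) (l t) < e"
      using l by blast
    then show "\<exists>n0. \<forall>n\<ge>n0. \<forall>t\<in>T. \<bar>(x n - y) t\<bar> \<le> e"
      by (intro exI[of _ n0]) (auto simp: y_def dist_real_def less_imp_le)
  qed
  ultimately show "\<exists>y\<in>C_space T. (\<lambda>n. sup_norm T (x n - y)) \<longlonglongrightarrow> 0" by blast
qed

text \<open>Evaluation at \<open>t\<close> is the inner product with a kernel of norm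
  \<open>sqrt t\<close>, at most \<open>1\<close> on \<open>T\<close>. The estimate yields
  continuity of the embedding and lets density transfer from the inner product norm to the sup
  norm.\<close>

lemma sup_norm_le_inner_norm:
  assumes h: "h \<in> H_space T"
  shows "sup_norm T h \<le> inner_norm (H_inner T) h"
proof (rule sup_norm_le)
  fix t assume t: "t \<in> T"
  have "\<bar>h t\<bar> \<le> inner_norm (H_inner T) h * inner_norm (H_inner T) (min_kernel t)"
    using H.Cauchy_Schwarz[OF h kernel_in_H_space[OF t]] H_inner_kernel[OF h t] by simp
  also have "inner_norm (H_inner T) (min_kernel t) = sqrt t"
    using H_inner_kernel[OF kernel_in_H_space[OF t] t] t by (simp add: inner_norm_def min_kernel_def)
  also have "inner_norm (H_inner T) h * sqrt t \<le> inner_norm (H_inner T) h * 1"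
    using T_bounds[OF t] H.norm_nonneg[OF h] by (intro mult_left_mono) auto
  finally show "\<bar>h t\<bar> \<le> inner_norm (H_inner T) h" by simp
qed

section \<open>Grids adapted to gaps and piecewise linear interpolation\<close>

text \<open>A step of length at least \<open>d\<close> has no point of \<open>T\<close> in its interior, so that interpolation on
  it is only tested at its end points.\<close>

definition grid :: "real \<Rightarrow> (nat \<Rightarrow> real) \<Rightarrow> nat \<Rightarrow> bool"
  where "grid d \<tau> n \<longleftrightarrow> \<tau> 0 = 0 \<and> (\<forall>i\<le>n. \<tau> i \<in> T) \<and>
    (\<forall>i<n. \<tau> i < \<tau> (Suc i) \<and> (\<tau> (Suc i) - \<tau> i < d \<or> {\<tau> i<..<\<tau> (Suc i)} \<inter> T = {}))"

text \<open>Grids increase strictly, so for \<open>r = r'\<close> the old grid is kept. Allowing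
  this case spares \<open>grid_exists\<close> from asking whether the neighbours of a level in
  \<open>T\<close> coincide.\<close>

lemma grid_extend:
  assumes "\<exists>\<tau> n. grid d \<tau> n \<and> \<tau> n = r" and "r' \<in> T" and "r \<le> r'"
    and "r' - r < d \<or> {r<..<r'} \<inter> T = {}"
  shows "\<exists>\<tau> n. grid d \<tau> n \<and> \<tau> n = r'"
proof (cases "r = r'")
  case False
  obtain \<tau> n where "grid d \<tau> n" "\<tau> n = r" using assms(1) by blast
  then have "grid d (\<tau>(Suc n := r')) (Suc n)"
    using assms False by (auto simp: grid_def less_Suc_eq le_Suc_eq)
  then show ?thesis by (intro exI[of _ "\<tau>(Suc n := r')"] exI[of _ "Suc n"]) simp
qed (use assms in blast)

text \<open>Induction over levels of spacing \<open>d / 2\<close>, which bounds the number of steps.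
  At a level \<open>a\<close> the grid is extended from the last point \<open>r0\<close> of
  \<open>T\<close> up to \<open>a\<close> to the first point \<open>r1\<close> from \<open>a\<close>
  on, with no point of \<open>T\<close> in between, and then from \<open>r1\<close> to
  \<open>r\<close>, a distance of at most \<open>d / 2\<close>.\<close>

lemma grid_exists:
  assumes "d > 0" and "r \<in> T"
  shows "\<exists>\<tau> n. grid d \<tau> n \<and> \<tau> n = r"
proof -
  have "\<forall>r\<in>T. r \<le> real k * (d / 2) \<longrightarrow> (\<exists>\<tau> n. grid d \<tau> n \<and> \<tau> n = r)" for k
  proof (induction k)
    case 0
    have "grid d (\<lambda>_. 0) 0" using zero_in_T by (simp add: grid_def)
    then show ?case using T_bounds by force
  next
    case (Suc k)
    show ?case
    proof (intro ballI impI)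
      fix r assume r: "r \<in> T" "r \<le> real (Suc k) * (d / 2)"
      define a where "a = real k * (d / 2)"
      show "\<exists>\<tau> n. grid d \<tau> n \<and> \<tau> n = r"
      proof (cases "r \<le> a")
        case True
        then show ?thesis using Suc.IH r by (simp add: a_def)
      next
        case False
        define r0 r1 where "r0 = Sup {u \<in> T. u \<le> a}" and "r1 = Inf {u \<in> T. a \<le> u}"
        have "a \<ge> 0" using \<open>d > 0\<close> by (simp add: a_def)
        have bdd: "bdd_above {u \<in> T. u \<le> a}" "bdd_below {u \<in> T. a \<le> u}"
          by (auto intro: bdd_aboveI[of _ a] bdd_belowI[of _ a])
        have mem: "r0 \<in> T" "r1 \<in> T"
          unfolding r0_def r1_def using bdd r False zero_in_T \<open>a \<ge> 0\<close>
          by (auto intro!: closed_subset_contains_Sup[OF closed_T] closed_subset_contains_Inf[OF closed_T])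
        have "r0 \<le> a"
          unfolding r0_def using zero_in_T \<open>a \<ge> 0\<close> by (intro cSup_least) auto
        have "a \<le> r1"
          unfolding r1_def using r False by (intro cInf_greatest) auto
        have r0_ge: "u \<le> r0" if "u \<in> T" "u \<le> a" for u
          unfolding r0_def using bdd that by (intro cSup_upper) auto
        have r1_le: "r1 \<le> u" if "u \<in> T" "a \<le> u" for u
          unfolding r1_def using bdd that by (intro cInf_lower) auto
        have "{r0<..<r1} \<inter> T = {}"
          using r0_ge r1_le by (force simp: not_le)
        moreover have "\<exists>\<tau> n. grid d \<tau> n \<and> \<tau> n = r0"
          using Suc.IH mem \<open>r0 \<le> a\<close> by (simp add: a_def)
        ultimately have "\<exists>\<tau> n. grid d \<tau> n \<and> \<tau> n = r1"
          using mem \<open>r0 \<le> a\<close> \<open>a \<le> r1\<close> by (intro grid_extend[of d r0 r1]) auto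
        moreover have "r1 \<le> r" using r1_le r False by simp
        moreover have "r - r1 < d"
          using r \<open>a \<le> r1\<close> \<open>d > 0\<close> by (simp add: a_def field_simps)
        ultimately show ?thesis
          using r by (intro grid_extend[of d r1 r]) auto
      qed
    qed
  qed
  moreover obtain k where "r / (d / 2) \<le> real k"
    using real_arch_simple by blast
  then have "r \<le> real k * (d / 2)"
    using \<open>d > 0\<close> by (simp add: field_simps)
  ultimately show ?thesis using assms(2) by blast
qed

text \<open>On \<open>T\<close>, the difference of two consecutive kernels is a ramp:
  \<open>0\<close> up to \<open>\<tau> i\<close>, slope \<open>1\<close> across the step, constant
  afterwards. Writing the interpolation through kernels puts it into \<open>H_space T\<close> and
  makes functionals computable on it.\<close>

definition interpolation :: "(nat \<Rightarrow> real) \<Rightarrow> nat \<Rightarrow> (real \<Rightarrow> real) \<Rightarrow> real \<Rightarrow> real"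
  where "interpolation \<tau> n \<omega> =
    (\<Sum>i<n. ((\<omega> (\<tau> (Suc i)) - \<omega> (\<tau> i)) / (\<tau> (Suc i) - \<tau> i)) *\<^sub>R (min_kernel (\<tau> (Suc i)) - min_kernel (\<tau> i)))"

lemma interpolation_in_H_space:
  assumes "grid d \<tau> n"
  shows "interpolation \<tau> n \<omega> \<in> H_space T"
  unfolding interpolation_def using assms
  by (intro H.sum_mem H.scaleR_mem H.diff_mem kernel_in_H_space) (auto simp: grid_def)

text \<open>The first conjunct carries the induction on \<open>n\<close>: a further step adds a ramp
  to a function that is already constant, equal to \<open>\<omega> (\<tau> n)\<close>, from the last
  grid point on.\<close>

lemma interpolation_error:
  assumes "grid d \<tau> n" and \<omega>: "\<omega> \<in> C_space T" and s: "s \<in> T" and "e \<ge> 0"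
    and modulus: "\<And>s t. s \<in> T \<Longrightarrow> t \<in> T \<Longrightarrow> \<bar>s - t\<bar> < d \<Longrightarrow> \<bar>\<omega> s - \<omega> t\<bar> \<le> e"
  shows "(\<tau> n \<le> s \<longrightarrow> interpolation \<tau> n \<omega> s = \<omega> (\<tau> n)) \<and>
    (s \<le> \<tau> n \<longrightarrow> \<bar>interpolation \<tau> n \<omega> s - \<omega> s\<bar> \<le> e)"
  using assms(1)
proof (induction n)
  case 0
  then show ?case
    using T_bounds[OF s] C_space_zero[OF \<omega>] \<open>e \<ge> 0\<close> by (auto simp: interpolation_def grid_def)
next
  case (Suc n)
  define a b where "a = \<tau> n" and "b = \<tau> (Suc n)"
  have ab: "a \<in> T" "b \<in> T" "a < b" "b - a < d \<or> {a<..<b} \<inter> T = {}"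
    using Suc.prems by (auto simp: grid_def a_def b_def)
  have "grid d \<tau> n" using Suc.prems by (simp add: grid_def)
  then have IH: "a \<le> s \<Longrightarrow> interpolation \<tau> n \<omega> s = \<omega> a"
      "s \<le> a \<Longrightarrow> \<bar>interpolation \<tau> n \<omega> s - \<omega> s\<bar> \<le> e"
    using Suc.IH by (auto simp: a_def)
  have step: "interpolation \<tau> (Suc n) \<omega> s =
      interpolation \<tau> n \<omega> s + (\<omega> b - \<omega> a) / (b - a) * (min s b - min s a)"
    using s by (simp add: interpolation_def min_kernel_def scaleR_fun_def a_def b_def)
  consider "s \<le> a" | "b \<le> s" | "a < s" "s < b" by linarith
  then show ?case
  proof cases
    case 1
    then show ?thesis
      using step IH ab by (simp flip: a_def b_def)
  next
    case 2
    then have "interpolation \<tau> (Suc n) \<omega> s = \<omega> b"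
      using step IH ab by simp
    then show ?thesis
      using 2 \<open>e \<ge> 0\<close> by (auto simp flip: b_def)
  next
    case 3
    \<comment> \<open>Here \<open>s\<close> is a point of \<open>T\<close> inside the step, which
      excludes the gap alternative. The value is then a convex combination of two values of
      \<open>\<omega>\<close> within \<open>e\<close> of \<open>\<omega> s\<close>.\<close>
    then have "b - a < d" using ab s by auto
    define \<theta> where "\<theta> = (s - a) / (b - a)"
    have \<theta>: "0 \<le> \<theta>" "\<theta> \<le> 1"
      using 3 by (auto simp: \<theta>_def)
    have "interpolation \<tau> (Suc n) \<omega> s - \<omega> s = (1 - \<theta>) * (\<omega> a - \<omega> s) + \<theta> * (\<omega> b - \<omega> s)"
    proof -
      have "interpolation \<tau> (Suc n) \<omega> s = \<omega> a + \<theta> * (\<omega> b - \<omega> a)"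
        using step IH 3 by (simp add: \<theta>_def)
      then show ?thesis by (simp add: algebra_simps)
    qed
    also have "\<bar>\<dots>\<bar> \<le> (1 - \<theta>) * \<bar>\<omega> a - \<omega> s\<bar> + \<theta> * \<bar>\<omega> b - \<omega> s\<bar>"
      using \<theta> by (intro order_trans[OF abs_triangle_ineq]) (simp add: abs_mult)
    also have "\<dots> \<le> (1 - \<theta>) * e + \<theta> * e"
      using \<theta> 3 ab s \<open>b - a < d\<close> by (intro add_mono mult_left_mono modulus) auto
    also have "\<dots> = e" by (simp add: algebra_simps)
    finally show ?thesis
      using 3 by (simp flip: b_def)
  qed
qed

lemma interpolation_tendsto:
  assumes grid: "\<And>k. grid (1 / Suc k) (\<tau> k) (n k)" "\<And>k. \<tau> k (n k) = 1" and \<omega>: "\<omega> \<in> C_space T"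
  shows "(\<lambda>k. sup_norm T (interpolation (\<tau> k) (n k) \<omega> - \<omega>)) \<longlonglongrightarrow> 0"
proof (rule sup_norm_tendsto_0)
  show "interpolation (\<tau> k) (n k) \<omega> - \<omega> \<in> C_space T" for k
    using interpolation_in_H_space[OF grid(1)] H_space_subset_C_space \<omega> by (intro C.diff_mem) auto
  fix e :: real assume "e > 0"
  have "uniformly_continuous_on T \<omega>"
    using compact_uniformly_continuous[OF C_space_continuous[OF \<omega>] compact_T] .
  then obtain d where d: "d > 0" "\<And>s t. s \<in> T \<Longrightarrow> t \<in> T \<Longrightarrow> dist s t < d \<Longrightarrow> dist (\<omega> s) (\<omega> t) < e"
    unfolding uniformly_continuous_on_def using \<open>e > 0\<close> by metis
  obtain k0 where k0: "1 / real (Suc k0) < d"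
    using nat_approx_posE[OF d(1)] by blast
  have "\<bar>(interpolation (\<tau> k) (n k) \<omega> - \<omega>) s\<bar> \<le> e" if "k \<ge> k0" "s \<in> T" for k s
  proof -
    have "1 / real (Suc k) \<le> 1 / real (Suc k0)"
      using that by (simp add: frac_le)
    then have "\<bar>\<omega> s - \<omega> t\<bar> \<le> e" if "s \<in> T" "t \<in> T" "\<bar>s - t\<bar> < 1 / real (Suc k)" for s t
      using d(2)[of s t] that k0 by (simp add: dist_real_def)
    then show ?thesis
      using interpolation_error[OF grid(1) \<omega> \<open>s \<in> T\<close>, of e] \<open>e > 0\<close> grid(2) T_bounds[OF \<open>s \<in> T\<close>] by simp
  qed
  then show "\<exists>k0. \<forall>k\<ge>k0. \<forall>s\<in>T. \<bar>(interpolation (\<tau> k) (n k) \<omega> - \<omega>) s\<bar> \<le> e" by blast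
qed

lemma grid_sequence_exists: "\<exists>\<tau> n. \<forall>k. grid (1 / Suc k) (\<tau> k) (n k) \<and> \<tau> k (n k) = 1"
proof -
  have "\<exists>\<tau> n. grid (1 / Suc k) \<tau> n \<and> \<tau> n = 1" for k
    by (rule grid_exists[OF _ one_in_T]) simp
  then show ?thesis by metis
qed

lemma H_space_dense:
  assumes \<omega>: "\<omega> \<in> C_space T" and "e > 0"
  shows "\<exists>h\<in>H_space T. sup_norm T (\<omega> - h) < e"
proof -
  obtain \<tau> n where grid: "\<And>k. grid (1 / Suc k) (\<tau> k) (n k)" "\<And>k. \<tau> k (n k) = 1"
    using grid_sequence_exists by auto
  obtain k where "sup_norm T (interpolation (\<tau> k) (n k) \<omega> - \<omega>) < e"
    using order_tendstoD(2)[OF interpolation_tendsto[OF grid \<omega>] \<open>e > 0\<close>]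
    by (auto simp: eventually_sequentially)
  moreover have h: "interpolation (\<tau> k) (n k) \<omega> \<in> H_space T"
    by (rule interpolation_in_H_space[OF grid(1)])
  ultimately show ?thesis
    using C.norm_minus_commute[OF \<omega>, of "interpolation (\<tau> k) (n k) \<omega>"] H_space_subset_C_space
    by (intro bexI[OF _ h]) auto
qed

text \<open>A countable dense subset of \<open>H_space T\<close> is also dense here, because
  \<open>H_space T\<close> is dense and its norm dominates the sup norm.\<close>

lemma C_space_separable: "separable_space (norm_topology (C_space T) (sup_norm T))"
  unfolding C.separable_space_iff
proof -
  obtain D where D: "D \<subseteq> H_space T" "countable D"
    and dense: "\<And>h e. h \<in> H_space T \<Longrightarrow> e > 0 \<Longrightarrow> \<exists>d\<in>D. inner_norm (H_inner T) (h - d) < e"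
    using H_space_separable unfolding H.separable_space_iff by blast
  have "\<exists>d\<in>D. sup_norm T (\<omega> - d) < e" if \<omega>: "\<omega> \<in> C_space T" and "e > 0" for \<omega> e
  proof -
    obtain h where h: "h \<in> H_space T" "sup_norm T (\<omega> - h) < e / 2"
      using H_space_dense[OF \<omega>, of "e / 2"] \<open>e > 0\<close> by auto
    obtain d where d: "d \<in> D" "inner_norm (H_inner T) (h - d) < e / 2"
      using dense[OF h(1), of "e / 2"] \<open>e > 0\<close> by auto
    have dH: "d \<in> H_space T" using d D by auto
    have "sup_norm T (\<omega> - d) \<le> sup_norm T (\<omega> - h) + sup_norm T (h - d)"
      using C.norm_triangle[of "\<omega> - h" "h - d"] \<omega> h dH H_space_subset_C_space
      by (auto simp: C.diff_mem subset_iff)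
    also have "\<dots> < e"
      using h d sup_norm_le_inner_norm[OF H.diff_mem[OF h(1) dH]] by linarith
    finally show ?thesis using d by blast
  qed
  then show "\<exists>D\<subseteq>C_space T. countable D \<and> (\<forall>x\<in>C_space T. \<forall>e>0. \<exists>d\<in>D. sup_norm T (x - d) < e)"
    using D H_space_subset_C_space by (intro exI[of _ D]) auto
qed

lemma C_space_separable_banach: "separable_banach_on (C_space T) (sup_norm T)"
  by unfold_locales
    (simp_all add: subspace_C_space C.norm_nonneg C.norm_eq_0_iff C.norm_scaleR C.norm_triangle
      C_space_mcomplete C_space_separable)

end

section \<open>Brownian motion on a time scale\<close>

context standard_brownian_motion
begin

text \<open>The coefficient sits inside the random variable and the characteristic function is taken
  at \<open>1\<close>, since the product formula for independent sums evaluates all factors at one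
  common argument.\<close>

lemma increment_char:
  assumes "0 \<le> s" "s < t" "t \<le> 1"
  shows "char (distr M borel (\<lambda>w. c * (B t w - B s w))) 1 =
    complex_of_real (exp (- (c\<^sup>2 * (t - s)) / 2))"
proof -
  define \<sigma> where "\<sigma> = sqrt (t - s)"
  have \<sigma>: "\<sigma> > 0" "\<sigma>\<^sup>2 = t - s" using assms by (simp_all add: \<sigma>_def)
  have [measurable]: "B s \<in> borel_measurable M" "B t \<in> borel_measurable M"
    using assms by (auto intro: random_variable)
  define Z where "Z w = (B t w - B s w) / \<sigma>" for w
  have [measurable]: "Z \<in> borel_measurable M"
    unfolding Z_def by measurable
  have "distributed M lborel (\<lambda>w. B t w - B s w) (normal_density 0 \<sigma>)"
    unfolding \<sigma>_def using assms by (rule gaussian_increments)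
  then have "distributed M lborel Z std_normal_density"
    unfolding Z_def using normal_standard_normal_convert[OF \<sigma>(1), of "\<lambda>w. B t w - B s w" 0] by simp
  then have Z: "distr M lborel Z = std_normal_distribution"
    by (simp add: distributed_def)
  have "char (distr M borel (\<lambda>w. c * (B t w - B s w))) 1 = (LINT w|M. iexp (c * (B t w - B s w)))"
    unfolding char_def by (subst integral_distr) auto
  also have "\<dots> = (LINT w|M. iexp (c * \<sigma> * Z w))"
    using \<sigma> by (simp add: Z_def)
  also have "\<dots> = char (distr M lborel Z) (c * \<sigma>)"
    unfolding char_def by (subst integral_distr) auto
  also have "\<dots> = complex_of_real (exp (- (c\<^sup>2 * (t - s)) / 2))"
    unfolding Z char_std_normal_distribution using \<sigma> by (simp add: power_mult_distrib)
  finally show ?thesis .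
qed

lemma increments_combination_char:
  assumes "\<tau> ` {..n} \<subseteq> {0..1}" and "\<And>i. i < n \<Longrightarrow> \<tau> i < \<tau> (Suc i)"
  shows "(LINT w|M. iexp (\<Sum>i<n. c i * (B (\<tau> (Suc i)) w - B (\<tau> i) w))) =
    complex_of_real (exp (- (\<Sum>i<n. (c i)\<^sup>2 * (\<tau> (Suc i) - \<tau> i)) / 2))"
proof -
  define X where "X i w = c i * (B (\<tau> (Suc i)) w - B (\<tau> i) w)" for i w
  have \<tau>: "\<tau> i \<in> {0..1}" if "i \<le> n" for i using assms(1) that by auto
  have "indep_vars (\<lambda>_. borel) (\<lambda>i w. B (\<tau> (Suc i)) w - B (\<tau> i) w) {..<n}"
    using assms by (rule independent_increments)
  then have indep: "indep_vars (\<lambda>_. borel) X {..<n}"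
    unfolding X_def by (rule indep_vars_compose2) simp
  have [measurable]: "X i \<in> borel_measurable M" if "i < n" for i
    unfolding X_def using that \<tau> by (intro measurable random_variable borel_measurable_times borel_measurable_diff) auto
  have "(LINT w|M. iexp (\<Sum>i<n. X i w)) = char (distr M borel (\<lambda>w. \<Sum>i<n. X i w)) 1"
    unfolding char_def by (subst integral_distr) auto
  also have "\<dots> = (\<Prod>i<n. char (distr M borel (X i)) 1)"
    by (rule char_distr_sum[OF indep])
  also have "\<dots> = (\<Prod>i<n. complex_of_real (exp (- ((c i)\<^sup>2 * (\<tau> (Suc i) - \<tau> i)) / 2)))"
    unfolding X_def using assms(2) \<tau> by (intro prod.cong refl increment_char) (auto simp: Suc_le_eq)
  also have "\<dots> = complex_of_real (exp (\<Sum>i<n. - ((c i)\<^sup>2 * (\<tau> (Suc i) - \<tau> i)) / 2))"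
    by (simp add: exp_sum)
  also have "(\<Sum>i<n. - ((c i)\<^sup>2 * (\<tau> (Suc i) - \<tau> i)) / 2) = - (\<Sum>i<n. (c i)\<^sup>2 * (\<tau> (Suc i) - \<tau> i)) / 2"
    by (simp add: sum_negf sum_divide_distrib)
  finally show ?thesis by (simp add: X_def)
qed

end

section \<open>Sampled paths, their law and its characteristic functional\<close>

locale sampled_brownian_motion = time_scale T + standard_brownian_motion M B
  for T :: "real set" and M :: "'w measure" and B :: "real \<Rightarrow> 'w \<Rightarrow> real"
begin

definition sampled_path :: "'w \<Rightarrow> real \<Rightarrow> real"
  where "sampled_path w t = (if t \<in> T then B t w else 0)"

lemma sampled_path_in_C_space:
  assumes "w \<in> space M"
  shows "sampled_path w \<in> C_space T"
proof -
  have "continuous_on T (\<lambda>t. B t w)"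
    using continuous_paths[OF assms] T_subset by (rule continuous_on_subset)
  then have "continuous_on T (sampled_path w)"
    by (rule continuous_on_eq) (simp add: sampled_path_def)
  then show ?thesis
    using start[OF assms] by (auto simp: C_space_def sampled_path_def)
qed

text \<open>By continuity, membership of a path in a closed ball is decided on a countable dense set
  of times, hence by countably many conditions on single random variables.\<close>

lemma sampled_path_measurable: "sampled_path \<in> measurable M (norm_borel (C_space T) (sup_norm T))"
proof (rule C.measurable_norm_borel[OF C_space_separable])
  show "sampled_path \<in> space M \<rightarrow> C_space T" using sampled_path_in_C_space by auto
next
  fix d :: "real \<Rightarrow> real" and r :: real assume d: "d \<in> C_space T"
  obtain T0 where T0: "countable T0" "T0 \<subseteq> T" "T \<subseteq> closure T0"
    using separable by blast
  have closure: "closure T0 = T"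
    using T0 closed_T closure_minimal by blast
  have "T0 \<noteq> {}" using closure zero_in_T by auto
  have "sup_norm T (sampled_path w - d) \<le> r \<longleftrightarrow> (\<forall>t\<in>T0. \<bar>B t w - d t\<bar> \<le> r)" if w: "w \<in> space M" for w
  proof
    have diff: "sampled_path w - d \<in> C_space T"
      using sampled_path_in_C_space[OF w] d by (rule C.diff_mem)
    show "\<forall>t\<in>T0. \<bar>B t w - d t\<bar> \<le> r" if "sup_norm T (sampled_path w - d) \<le> r"
      using abs_le_sup_norm[OF diff] that T0 by (fastforce simp: sampled_path_def)
    assume *: "\<forall>t\<in>T0. \<bar>B t w - d t\<bar> \<le> r"
    have "continuous_on (closure T0) (\<lambda>t. \<bar>(sampled_path w - d) t\<bar>)"
      unfolding closure using C_space_continuous[OF diff] by (intro continuous_intros)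
    moreover have "\<bar>(sampled_path w - d) t\<bar> \<le> r" if "t \<in> T0" for t
      using * that T0 by (auto simp: sampled_path_def)
    ultimately have "\<bar>(sampled_path w - d) t\<bar> \<le> r" if "t \<in> T" for t
      using continuous_le_on_closure[of T0 "\<lambda>t. \<bar>(sampled_path w - d) t\<bar>" t r] that closure by blast
    then show "sup_norm T (sampled_path w - d) \<le> r" by (rule sup_norm_le)
  qed
  then have "{w \<in> space M. sup_norm T (sampled_path w - d) \<le> r} =
      (\<Inter>t\<in>T0. {w \<in> space M. \<bar>B t w - d t\<bar> \<le> r})"
    using \<open>T0 \<noteq> {}\<close> by auto
  also have "\<dots> \<in> sets M"
  proof (rule sets.countable_INT'[OF T0(1) \<open>T0 \<noteq> {}\<close>], safe)
    fix t assume "t \<in> T0"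
    then have [measurable]: "B t \<in> borel_measurable M"
      using T0 T_subset by (intro random_variable) auto
    show "{w \<in> space M. \<bar>B t w - d t\<bar> \<le> r} \<in> sets M" by measurable
  qed
  finally show "{w \<in> space M. sup_norm T (sampled_path w - d) \<le> r} \<in> sets M" .
qed

lemma sampled_wiener_measure_eq:
  "sampled_wiener_measure T M B = distr M (norm_borel (C_space T) (sup_norm T)) sampled_path"
  unfolding sampled_wiener_measure_def sampled_path_def[abs_def] ..

text \<open>Representation by \<open>k\<close> together with evaluation by kernels gives
  \<open>l (min_kernel t) = k t\<close>. The resulting sum is symmetric in \<open>k\<close> and
  \<open>\<omega>\<close>, so the slopes may be moved from \<open>\<omega>\<close> to
  \<open>k\<close>, leaving a linear combination of increments of \<open>\<omega>\<close> with
  deterministic coefficients.\<close>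

lemma dual_on_interpolation:
  assumes l: "l \<in> dual_on (C_space T) (sup_norm T)" and "grid d \<tau> n" and k: "k \<in> H_space T"
    and represents: "\<And>h. h \<in> H_space T \<Longrightarrow> H_inner T k h = l h"
  shows "l (interpolation \<tau> n \<omega>) =
    (\<Sum>i<n. (k (\<tau> (Suc i)) - k (\<tau> i)) / (\<tau> (Suc i) - \<tau> i) * (\<omega> (\<tau> (Suc i)) - \<omega> (\<tau> i)))"
proof -
  have K: "min_kernel (\<tau> i) \<in> C_space T" "l (min_kernel (\<tau> i)) = k (\<tau> i)" if "i \<le> n" for i
    using assms(2) that kernel_in_H_space[of "\<tau> i"] H_space_subset_C_space
      represents[of "min_kernel (\<tau> i)"] H_inner_kernel[OF k, of "\<tau> i"]
    by (auto simp: grid_def)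
  have "l (interpolation \<tau> n \<omega>) = (\<Sum>i<n. l (((\<omega> (\<tau> (Suc i)) - \<omega> (\<tau> i)) / (\<tau> (Suc i) - \<tau> i)) *\<^sub>R
      (min_kernel (\<tau> (Suc i)) - min_kernel (\<tau> i))))"
    unfolding interpolation_def using K
    by (intro C.dual_on_sum[OF l] C.scaleR_mem C.diff_mem) auto
  also have "\<dots> = (\<Sum>i<n. (k (\<tau> (Suc i)) - k (\<tau> i)) / (\<tau> (Suc i) - \<tau> i) * (\<omega> (\<tau> (Suc i)) - \<omega> (\<tau> i)))"
  proof (intro sum.cong refl)
    fix i assume "i \<in> {..<n}"
    then have i: "i \<le> n" "Suc i \<le> n" by auto
    show "l (((\<omega> (\<tau> (Suc i)) - \<omega> (\<tau> i)) / (\<tau> (Suc i) - \<tau> i)) *\<^sub>R (min_kernel (\<tau> (Suc i)) - min_kernel (\<tau> i))) =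
        (k (\<tau> (Suc i)) - k (\<tau> i)) / (\<tau> (Suc i) - \<tau> i) * (\<omega> (\<tau> (Suc i)) - \<omega> (\<tau> i))"
      using C.dual_on_linear(2)[OF l C.diff_mem C.zero_mem, OF K(1)[OF i(2)] K(1)[OF i(1)]]
        C.dual_on_linear(3)[OF l K(1)[OF i(2)] K(1)[OF i(1)]] K(2)[OF i(1)] K(2)[OF i(2)]
      by simp
  qed
  finally show ?thesis .
qed

lemma dual_on_H_space:
  assumes "l \<in> dual_on (C_space T) (sup_norm T)"
  shows "l \<in> dual_on (H_space T) (inner_norm (H_inner T))"
proof -
  have "continuous_map (norm_topology (H_space T) (inner_norm (H_inner T)))
      (norm_topology (C_space T) (sup_norm T)) (\<lambda>h. h)"
    by (intro bounded_embedding_continuous H.normed_on_axioms C.normed_on_axioms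
        H_space_subset_C_space sup_norm_le_inner_norm)
  then have "continuous_map (norm_topology (H_space T) (inner_norm (H_inner T))) euclideanreal (l \<circ> (\<lambda>h. h))"
    using assms by (intro continuous_map_compose) (auto simp: dual_on_def)
  then show ?thesis
    using assms H_space_subset_C_space by (auto simp: dual_on_def linear_between_def comp_def subset_iff)
qed

text \<open>Along finer and finer grids, \<open>l\<close> of the interpolated path is a combination of independent
  increments. Its variance is \<open>l\<close> of the interpolation of the Riesz representative \<open>k\<close>, which
  tends to \<open>l k\<close>.\<close>

lemma characteristic_functional:
  assumes l: "l \<in> dual_on (C_space T) (sup_norm T)"
  shows "(LINT \<omega>|sampled_wiener_measure T M B. exp (\<i> * complex_of_real (l \<omega>))) =
    complex_of_real (exp (- (inner_norm (H_inner T) (riesz_rep (H_space T) (H_inner T) (\<lambda>h. h) l))\<^sup>2 / 2))"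
proof -
  define k where "k = riesz_rep (H_space T) (H_inner T) (\<lambda>h. h) l"
  have "k \<in> H_space T \<and> (\<forall>h\<in>H_space T. H_inner T k h = l h)"
    unfolding k_def riesz_rep_def
    by (rule theI'[OF H.Riesz_representation[OF H_space_mcomplete dual_on_H_space[OF l]]])
  then have k: "k \<in> H_space T" and represents: "\<And>h. h \<in> H_space T \<Longrightarrow> H_inner T k h = l h"
    by auto
  have kC: "k \<in> C_space T" using k H_space_subset_C_space by auto
  obtain \<tau> n where grid: "\<And>j. grid (1 / Suc j) (\<tau> j) (n j)" "\<And>j. \<tau> j (n j) = 1"
    using grid_sequence_exists by auto
  define I where "I j = interpolation (\<tau> j) (n j)" for j
  have I_mem: "I j \<omega> \<in> C_space T" for j \<omega>
    unfolding I_def using interpolation_in_H_space[OF grid(1)] H_space_subset_C_space by blast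
  have lI_lim: "(\<lambda>j. l (I j \<omega>)) \<longlonglongrightarrow> l \<omega>" if "\<omega> \<in> C_space T" for \<omega>
    using interpolation_tendsto[OF grid that] that I_mem
    by (intro C.dual_on_tendsto[OF l]) (auto simp: I_def)
  have l_meas [measurable]: "l \<in> borel_measurable (norm_borel (C_space T) (sup_norm T))"
    by (rule C.dual_on_measurable[OF l])
  note sampled_path_measurable [measurable]
  define c where "c j i = (k (\<tau> j (Suc i)) - k (\<tau> j i)) / (\<tau> j (Suc i) - \<tau> j i)" for j i
  have step: "\<tau> j i < \<tau> j (Suc i)" "\<tau> j i \<in> T" "\<tau> j (Suc i) \<in> T" if "i < n j" for i j
    using grid(1)[of j] that by (auto simp: grid_def)
  have lI: "l (I j \<omega>) = (\<Sum>i<n j. c j i * (\<omega> (\<tau> j (Suc i)) - \<omega> (\<tau> j i)))" for j \<omega>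
    unfolding I_def c_def by (rule dual_on_interpolation[OF l grid(1) k represents])
  have lI_path: "l (I j (sampled_path w)) = (\<Sum>i<n j. c j i * (B (\<tau> j (Suc i)) w - B (\<tau> j i) w))" for j w
    unfolding lI using step by (intro sum.cong) (auto simp: sampled_path_def)
  \<comment> \<open>An increment of \<open>k\<close> is \<open>c j i\<close> times the step length,
    so one factor \<open>c j i\<close> becomes a square: the variance of the combination in
    \<open>lI_path\<close>.\<close>
  have lI_k: "l (I j k) = (\<Sum>i<n j. (c j i)\<^sup>2 * (\<tau> j (Suc i) - \<tau> j i))" for j
    unfolding lI using step by (intro sum.cong) (auto simp: c_def power2_eq_square)
  have lI_path_meas: "(\<lambda>w. l (I j (sampled_path w))) \<in> borel_measurable M" for j
    unfolding lI_path using T_bounds[OF step(2)] T_bounds[OF step(3)]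
    by (intro borel_measurable_sum borel_measurable_times borel_measurable_diff random_variable) auto
  have char_I: "(LINT w|M. iexp (l (I j (sampled_path w)))) = complex_of_real (exp (- l (I j k) / 2))" for j
    unfolding lI_path lI_k
  proof (rule increments_combination_char)
    show "\<tau> j ` {..n j} \<subseteq> {0..1}"
      using grid(1)[of j] T_subset by (auto simp: grid_def)
  qed (use step in auto)
  have "(\<lambda>j. LINT w|M. iexp (l (I j (sampled_path w)))) \<longlonglongrightarrow> (LINT w|M. iexp (l (sampled_path w)))"
  \<comment> \<open>The integrands have modulus \<open>1\<close>, and constants are integrable for a
    probability measure.\<close>
  proof (rule integral_dominated_convergence[where w = "\<lambda>_. 1"])
    show "(\<lambda>w. iexp (l (sampled_path w))) \<in> borel_measurable M" by measurable
    show "(\<lambda>w. iexp (l (I j (sampled_path w)))) \<in> borel_measurable M" for j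
      using lI_path_meas by measurable
    show "AE w in M. (\<lambda>j. iexp (l (I j (sampled_path w)))) \<longlonglongrightarrow> iexp (l (sampled_path w))"
      using lI_lim[OF sampled_path_in_C_space] by (intro AE_I2 tendsto_intros) auto
  qed auto
  moreover have "(\<lambda>j. complex_of_real (exp (- l (I j k) / 2))) \<longlonglongrightarrow> complex_of_real (exp (- l k / 2))"
    by (intro tendsto_intros lI_lim kC) auto
  ultimately have "(LINT w|M. iexp (l (sampled_path w))) = complex_of_real (exp (- l k / 2))"
    unfolding char_I by (rule LIMSEQ_unique)
  moreover have "l k = (inner_norm (H_inner T) k)\<^sup>2"
    using represents[OF k] H.inner_norm_power2[OF k] by simp
  moreover have "(LINT \<omega>|sampled_wiener_measure T M B. iexp (l \<omega>)) = (LINT w|M. iexp (l (sampled_path w)))"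
    unfolding sampled_wiener_measure_eq by (rule integral_distr[OF sampled_path_measurable]) measurable
  ultimately show ?thesis by (simp add: k_def)
qed

lemma abstract_wiener_space_sampled:
  "abstract_wiener_space (H_space T) (H_inner T) (C_space T) (sup_norm T) (\<lambda>h. h)
    (sampled_wiener_measure T M B)"
proof (intro abstract_wiener_space.intro abstract_wiener_space_axioms.intro)
  show "separable_hilbert_on (H_space T) (H_inner T)" by (rule H_space_separable_hilbert)
  show "separable_banach_on (C_space T) (sup_norm T)" by (rule C_space_separable_banach)
  show "linear_between (H_space T) (C_space T) (\<lambda>h. h)"
    using H_space_subset_C_space by (auto simp: linear_between_def)
  show "continuous_map (norm_topology (H_space T) (inner_norm (H_inner T)))
      (norm_topology (C_space T) (sup_norm T)) (\<lambda>h. h)"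
    by (intro bounded_embedding_continuous H.normed_on_axioms C.normed_on_axioms
        H_space_subset_C_space sup_norm_le_inner_norm)
  show "norm_topology (C_space T) (sup_norm T) closure_of ((\<lambda>h. h) ` H_space T) = C_space T"
    using H_space_dense by (simp add: C.closure_of_eq_carrier_iff[OF H_space_subset_C_space])
  show "prob_space (sampled_wiener_measure T M B)"
    unfolding sampled_wiener_measure_eq by (rule prob_space_distr[OF sampled_path_measurable])
  show "(LINT \<omega>|sampled_wiener_measure T M B. exp (\<i> * complex_of_real (l \<omega>))) =
      complex_of_real (exp (- (inner_norm (H_inner T) (riesz_rep (H_space T) (H_inner T) (\<lambda>h. h) l))\<^sup>2 / 2))"
    if "l \<in> dual_on (C_space T) (sup_norm T)" for l
    using that by (rule characteristic_functional)
qed (simp_all add: sampled_wiener_measure_def)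

end

theorem proposition3p2:
  fixes T :: "real set" and M :: "'w measure" and B :: "real \<Rightarrow> 'w \<Rightarrow> real"
  assumes "closed T" and "{0, 1} \<subseteq> T" and "T \<subseteq> {0..1}"
    and "standard_brownian_motion M B"
  shows "abstract_wiener_space (H_space T) (H_inner T) (C_space T) (sup_norm T)
    (\<lambda>h. h) (sampled_wiener_measure T M B)"
proof -
  interpret sampled_brownian_motion T M B
    using assms by (auto intro!: sampled_brownian_motion.intro time_scale.intro)
  show ?thesis by (rule abstract_wiener_space_sampled)
qed

end
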